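(* There is a polynomial-time algorithm that reads a classically valid sequent $S=(\Gamma\Rightarrow\bigvee_{i=1}^n p_i)$, where $n\ge1$, $\Gamma$ is a finite multiset of implicational Horn formulas and $p_1,\dots,p_n$ are atomic formulas of $\mathcal{L}_p$, and outputs an index $1\le i\le n$ together with an $\mathbf{LJ}$-proof $\pi$ of $\Gamma\Rightarrow p_i$.
   Context: $\mathcal{L}_p$ is the propositional language with atoms, $\top,\bot,\wedge,\vee,\to$. A sequent $\Gamma\Rightarrow\Lambda$ is classically valid if $\bigwedge\Gamma\to\bigvee\Lambda$ is a classical tautology. Implicational Horn formulas: $\bot$, atoms, and formulas $\bigwedge Q\to r$ where $Q$ is a non-empty finite multiset of atoms and $r$ is an atom or $\bot$. $\mathbf{LJ}$ is the single-conclusion sequent calculus (right side at most one formula; $\Gamma,\Delta$ multiset variables, $\Delta$ at most one formula) with rules: $\Gamma,p\Rightarrow p$; $\Gamma,\bot\Rightarrow\Delta$; $\Gamma\Rightarrow\top$; $\frac{\Gamma\Rightarrow\Delta}{\Gamma,p\Rightarrow\Delta}$; $\frac{\Gamma\Rightarrow}{\Gamma\Rightarrow p}$; $\frac{\Gamma,p,p\Rightarrow\Delta}{\Gamma,p\Rightarrow\Delta}$; cut $\frac{\Gamma\Rightarrow p\ \ \Gamma,p\Rightarrow\Delta}{\Gamma\Rightarrow\Delta}$; $\frac{\Gamma,p\Rightarrow\Delta}{\Gamma,p\wedge q\Rightarrow\Delta}$, $\frac{\Gamma,q\Rightarrow\Delta}{\Gamma,p\wedge q\Rightarrow\Delta}$,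 $\frac{\Gamma\Rightarrow p\ \ \Gamma\Rightarrow q}{\Gamma\Rightarrow p\wedge q}$, $\frac{\Gamma,p\Rightarrow\Delta\ \ \Gamma,q\Rightarrow\Delta}{\Gamma,p\vee q\Rightarrow\Delta}$, $\frac{\Gamma\Rightarrow p}{\Gamma\Rightarrow p\vee q}$, $\frac{\Gamma\Rightarrow q}{\Gamma\Rightarrow p\vee q}$, $\frac{\Gamma\Rightarrow p\ \ \Gamma,q\Rightarrow\Delta}{\Gamma,p\to q\Rightarrow\Delta}$, $\frac{\Gamma,p\Rightarrow q}{\Gamma\Rightarrow p\to q}$ (atoms in rules are schematic, substitutable by arbitrary formulas). Polynomial time is in the number of symbols of $S$. *)

theory Defs
  imports "HOL-Library.Multiset" "HOL-Computational_Algebra.Polynomial"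
begin

datatype form =
    Atom nat
  | Top
  | Bot
  | And form form
  | Or form form
  | Imp form form

text \<open>
  Iterated connectives are bracketed to the right, a one-element iteration is the formula itself,
  and the empty ones are \<open>\<top>\<close> and \<open>\<bottom>\<close>.
  The list fixes the order in which the members of a multiset are written down.
\<close>

fun Conj :: "form list \<Rightarrow> form" where
  "Conj [] = Top"
| "Conj [A] = A"
| "Conj (A # B # As) = And A (Conj (B # As))"

fun Disj :: "form list \<Rightarrow> form" where
  "Disj [] = Bot"
| "Disj [A] = A"
| "Disj (A # B # As) = Or A (Disj (B # As))"

primrec eval :: "(nat \<Rightarrow> bool) \<Rightarrow> form \<Rightarrow> bool" where
  "eval v (Atom a) \<longleftrightarrow> v a"
| "eval v Top \<longleftrightarrow> True"
| "eval v Bot \<longleftrightarrow> False"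
| "eval v (And A B) \<longleftrightarrow> eval v A \<and> eval v B"
| "eval v (Or A B) \<longleftrightarrow> eval v A \<or> eval v B"
| "eval v (Imp A B) \<longleftrightarrow> (eval v A \<longrightarrow> eval v B)"

definition tautology :: "form \<Rightarrow> bool" where
  "tautology A \<longleftrightarrow> (\<forall>v. eval v A)"

text \<open>
  A single-conclusion sequent as it is written down: the antecedent is a list enumerating the
  multiset of formulas, and the succedent is empty or one formula.
\<close>

type_synonym sequent = "form list \<times> form option"

fun classically_valid :: "sequent \<Rightarrow> bool" where
  "classically_valid (\<Gamma>, \<Delta>) \<longleftrightarrow>
     tautology (Imp (Conj \<Gamma>) (Disj (case \<Delta> of None \<Rightarrow> [] | Some A \<Rightarrow> [A])))"

definition implicational_horn :: "form \<Rightarrow> bool" where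
  "implicational_horn A \<longleftrightarrow>
     A = Bot \<or> (\<exists>a. A = Atom a) \<or>
     (\<exists>Q r. Q \<noteq> [] \<and> (r = Bot \<or> (\<exists>a. r = Atom a)) \<and> A = Imp (Conj (map Atom Q)) r)"

text \<open>
  \<open>LJ_rule Ps S\<close>: the sequent \<open>S\<close> follows from the list of premises \<open>Ps\<close> by one rule instance.
  Antecedents are multisets here, so there is no exchange rule.
\<close>

inductive LJ_rule :: "(form multiset \<times> form option) list \<Rightarrow> form multiset \<times> form option \<Rightarrow> bool"
  where
  Ax:   "LJ_rule [] (add_mset A \<Gamma>, Some A)"
| BotL: "LJ_rule [] (add_mset Bot \<Gamma>, \<Delta>)"
| TopR: "LJ_rule [] (\<Gamma>, Some Top)"
| WkL:  "LJ_rule [(\<Gamma>, \<Delta>)] (add_mset A \<Gamma>, \<Delta>)"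
| WkR:  "LJ_rule [(\<Gamma>, None)] (\<Gamma>, Some A)"
| CtrL: "LJ_rule [(add_mset A (add_mset A \<Gamma>), \<Delta>)] (add_mset A \<Gamma>, \<Delta>)"
| Cut:  "LJ_rule [(\<Gamma>, Some A), (add_mset A \<Gamma>, \<Delta>)] (\<Gamma>, \<Delta>)"
| AndL1: "LJ_rule [(add_mset A \<Gamma>, \<Delta>)] (add_mset (And A B) \<Gamma>, \<Delta>)"
| AndL2: "LJ_rule [(add_mset B \<Gamma>, \<Delta>)] (add_mset (And A B) \<Gamma>, \<Delta>)"
| AndR: "LJ_rule [(\<Gamma>, Some A), (\<Gamma>, Some B)] (\<Gamma>, Some (And A B))"
| OrL:  "LJ_rule [(add_mset A \<Gamma>, \<Delta>), (add_mset B \<Gamma>, \<Delta>)] (add_mset (Or A B) \<Gamma>, \<Delta>)"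
| OrR1: "LJ_rule [(\<Gamma>, Some A)] (\<Gamma>, Some (Or A B))"
| OrR2: "LJ_rule [(\<Gamma>, Some B)] (\<Gamma>, Some (Or A B))"
| ImpL: "LJ_rule [(\<Gamma>, Some A), (add_mset B \<Gamma>, \<Delta>)] (add_mset (Imp A B) \<Gamma>, \<Delta>)"
| ImpR: "LJ_rule [(add_mset A \<Gamma>, Some B)] (\<Gamma>, Some (Imp A B))"

datatype proof_tree = Node sequent "proof_tree list"

fun endsequent :: "proof_tree \<Rightarrow> form multiset \<times> form option" where
  "endsequent (Node (\<Gamma>, \<Delta>) \<pi>s) = (mset \<Gamma>, \<Delta>)"

fun LJ_proof :: "proof_tree \<Rightarrow> bool" where
  "LJ_proof (Node S \<pi>s) \<longleftrightarrow>
     (\<forall>\<pi> \<in> set \<pi>s. LJ_proof \<pi>) \<and> LJ_rule (map endsequent \<pi>s) (endsequent (Node S \<pi>s))"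

text \<open>
  There are infinitely many atoms, so over a finite alphabet the atom with index \<open>n\<close> is written
  as \<open>SVar\<close> followed by the binary digits of \<open>n\<close>. Formulas are in Polish notation.
\<close>

datatype symbol =
    SVar | S0 | S1
  | STop | SBot | SAnd | SOr | SImp
  | SComma | SArrow
  | SOpen | SClose

instance symbol :: finite
proof
  have "(UNIV :: symbol set) \<subseteq>
    {SVar, S0, S1, STop, SBot, SAnd, SOr, SImp, SComma, SArrow, SOpen, SClose}"
    by (auto intro: symbol.exhaust)
  then show "finite (UNIV :: symbol set)"
    by (rule finite_subset) simp
qed

text \<open>Least significant digit first, and no digits at all for \<open>0\<close>.\<close>

fun enc_nat :: "nat \<Rightarrow> symbol list" where
  "enc_nat n = (if n = 0 then [] else (if odd n then S1 else S0) # enc_nat (n div 2))"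

declare enc_nat.simps [simp del]

primrec enc_form :: "form \<Rightarrow> symbol list" where
  "enc_form (Atom a) = SVar # enc_nat a"
| "enc_form Top = [STop]"
| "enc_form Bot = [SBot]"
| "enc_form (And A B) = SAnd # enc_form A @ enc_form B"
| "enc_form (Or A B) = SOr # enc_form A @ enc_form B"
| "enc_form (Imp A B) = SImp # enc_form A @ enc_form B"

fun enc_sequent :: "sequent \<Rightarrow> symbol list" where
  "enc_sequent (\<Gamma>, \<Delta>) =
     concat (map (\<lambda>A. enc_form A @ [SComma]) \<Gamma>) @
     SArrow # (case \<Delta> of None \<Rightarrow> [] | Some A \<Rightarrow> enc_form A)"

fun enc_proof :: "proof_tree \<Rightarrow> symbol list" where
  "enc_proof (Node S \<pi>s) = SOpen # enc_sequent S @ concat (map enc_proof \<pi>s) @ [SClose]"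

definition enc_output :: "nat \<Rightarrow> proof_tree \<Rightarrow> symbol list" where
  "enc_output i \<pi> = enc_nat i @ enc_proof \<pi>"

text \<open>
  A cell holds \<open>None\<close> (blank) or \<open>Some a\<close>. In \<open>Tape ls a rs\<close> the head scans \<open>a\<close>, the cells to its
  left are \<open>ls\<close>, nearest first, those to its right are \<open>rs\<close>, and all cells beyond are blank.
\<close>

datatype 's tape = Tape "'s option list" "'s option" "'s option list"

datatype move = MLeft | MStay | MRight

fun read_tape :: "'s tape \<Rightarrow> 's option" where
  "read_tape (Tape ls a rs) = a"

fun write_tape :: "'s option \<Rightarrow> 's tape \<Rightarrow> 's tape" where
  "write_tape b (Tape ls a rs) = Tape ls b rs"

fun move_tape :: "move \<Rightarrow> 's tape \<Rightarrow> 's tape" where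
  "move_tape MStay t = t"
| "move_tape MLeft (Tape [] a rs) = Tape [] None (a # rs)"
| "move_tape MLeft (Tape (l # ls) a rs) = Tape ls l (a # rs)"
| "move_tape MRight (Tape ls a []) = Tape (a # ls) None []"
| "move_tape MRight (Tape ls a (r # rs)) = Tape (a # ls) r rs"

fun input_tape :: "'s list \<Rightarrow> 's tape" where
  "input_tape [] = Tape [] None []"
| "input_tape (a # w) = Tape [] (Some a) (map Some w)"

fun output_word :: "'s tape \<Rightarrow> 's list" where
  "output_word (Tape ls a rs) = map the (takeWhile (\<lambda>c. c \<noteq> None) (a # rs))"

text \<open>States are the numbers below \<open>num_states\<close>; the alphabet is the finite type \<open>'s\<close>.\<close>

record 's tm =
  num_states :: nat
  num_tapes :: nat
  start_state :: nat
  halt_state :: nat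
  transition :: "nat \<Rightarrow> 's option list \<Rightarrow> nat \<times> ('s option \<times> move) list"

definition turing_machine :: "('s :: finite) tm \<Rightarrow> bool" where
  "turing_machine M \<longleftrightarrow>
     2 \<le> num_tapes M \<and> start_state M < num_states M \<and> halt_state M < num_states M \<and>
     (\<forall>q cs. q < num_states M \<and> length cs = num_tapes M \<longrightarrow>
        (case transition M q cs of (q', acts) \<Rightarrow> q' < num_states M \<and> length acts = num_tapes M))"

fun tm_step :: "('s :: finite) tm \<Rightarrow> nat \<times> 's tape list \<Rightarrow> nat \<times> 's tape list" where
  "tm_step M (q, ts) =
     (if q = halt_state M then (q, ts)
      else case transition M q (map read_tape ts) of
        (q', acts) \<Rightarrow> (q', map2 (\<lambda>(b, m) t. move_tape m (write_tape b t)) acts ts))"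

definition tm_init :: "('s :: finite) tm \<Rightarrow> 's list \<Rightarrow> nat \<times> 's tape list" where
  "tm_init M x =
     (start_state M, input_tape x # replicate (num_tapes M - 1) (input_tape []))"

text \<open>
  \<open>M\<close>, started with \<open>x\<close> on tape 0, halts after at most \<open>T\<close> steps, and the word on tape 1 from the
  head up to the first blank is \<open>y\<close>. Halted configurations are fixed by \<^const>\<open>tm_step\<close>.
\<close>

definition computes_within :: "('s :: finite) tm \<Rightarrow> 's list \<Rightarrow> nat \<Rightarrow> 's list \<Rightarrow> bool" where
  "computes_within M x T y \<longleftrightarrow>
     (\<exists>ts. (tm_step M ^^ T) (tm_init M x) = (halt_state M, ts) \<and> output_word (ts ! 1) = y)"

end

theory Submission
  imports Defs
begin

text \<open>
  Unit propagation on the Horn clauses of \<open>\<Gamma>\<close> derives a set \<open>X\<close> of atoms and possibly \<open>\<bottom>\<close>. If \<open>\<bottom> \<notin> X\<close>,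
  the valuation making exactly the atoms of \<open>X\<close> true satisfies \<open>\<Gamma>\<close>, so by validity some \<open>p\<^sub>i\<close> is in \<open>X\<close>;
  if \<open>\<bottom> \<in> X\<close>, every \<open>i\<close> will do. Each propagation step that adds \<open>h\<close> becomes a cut on \<open>h\<close>, whose left
  premise is a short derivation of \<open>h\<close> from the context collected so far, and the innermost leaf of the
  chain of cuts is an axiom. The root of every cut already mentions \<open>p\<^sub>i\<close>, so the machine propagates
  twice: once to find \<open>i\<close>, and once to print the proof.

  The machine is not built by hand. The algorithm is written in a loop language on string registers
  whose loops run once over the content of a register that their body does not modify. A program
  is compiled to a Turing machine with one tape per register. If the registers can be given levels
  such that every push in the body of a loop is to a register of higher level than the one the loop
  runs over, then the lengths of all registers, and hence the running time, are polynomially bounded.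
\<close>

section \<open>A loop language on string registers\<close>

text \<open>Without the levels, two registers that are appended to each other in a loop would grow
  exponentially. With them, a register's length is polynomial in the lengths of registers of lower
  level, and the number of levels depends on the program only, so boundedly many polynomials are
  composed. Nothing checks whether a head has been derived before, so a clause fires again in every
  later round. This only lengthens the chain of cuts, to at most rounds times clauses, and repeated
  literals do no harm, because axioms admit any context. The goal influences nothing but the printed
  text, so both propagations fire the same clauses. The rules are arranged so that formulas are only
  added at the ends of the antecedent, and no list is ever edited in the middle.\<close>

type_synonym regs = "nat \<Rightarrow> symbol list"

text \<open>A register holds a word, and pushing appends to its end while popping removes its first symbol.
  \<open>Copy s r\<close> pushes the first symbol of \<open>s\<close> onto \<open>r\<close>. In the body of \<open>Loop r P\<close> the register \<open>r\<close> shows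
  only the current symbol; on the tape, this is the symbol under the head.\<close>

datatype prog =
    Skip
  | Push nat symbol
  | Copy nat nat
  | Pop nat
  | Clear nat
  | Inc nat
  | IfTop nat "symbol option" prog prog
  | IfSame nat nat prog prog
  | Loop nat prog
  | Seq prog prog  (infixr ";;" 65)

fun peek :: "'a list \<Rightarrow> 'a option" where
  "peek [] = None"
| "peek (a # w) = Some a"

lemma peek_eq_None [simp]: "peek w = None \<longleftrightarrow> w = []"
  by (cases w) auto

lemma peek_append: "v \<noteq> [] \<Longrightarrow> peek (v @ w) = peek v"
  by (cases v) auto

fun inc :: "symbol list \<Rightarrow> symbol list" where
  "inc [] = [S1]"
| "inc (a # w) = (if a = S1 then S0 # inc w else S1 # w)"

lemma length_inc: "length (inc w) \<le> Suc (length w)"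
  by (induction w) auto

primrec exec :: "prog \<Rightarrow> regs \<Rightarrow> regs" where
  "exec Skip \<sigma> = \<sigma>"
| "exec (Push r a) \<sigma> = \<sigma>(r := \<sigma> r @ [a])"
| "exec (Copy s r) \<sigma> = \<sigma>(r := \<sigma> r @ take 1 (\<sigma> s))"
| "exec (Pop r) \<sigma> = \<sigma>(r := tl (\<sigma> r))"
| "exec (Clear r) \<sigma> = \<sigma>(r := [])"
| "exec (Inc r) \<sigma> = \<sigma>(r := inc (\<sigma> r))"
| "exec (IfTop r c P Q) \<sigma> = (if peek (\<sigma> r) = c then exec P \<sigma> else exec Q \<sigma>)"
| "exec (IfSame r s P Q) \<sigma> = (if peek (\<sigma> r) = peek (\<sigma> s) then exec P \<sigma> else exec Q \<sigma>)"
| "exec (Loop r P) \<sigma> = (fold (\<lambda>a \<tau>. exec P (\<tau>(r := [a]))) (\<sigma> r) \<sigma>)(r := \<sigma> r)"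
| "exec (Seq P Q) \<sigma> = exec Q (exec P \<sigma>)"

text \<open>The loop without the final restoration of \<open>r\<close>. Applied to prefixes of the
  word, it gives the state between two passes, where loop invariants are stated.\<close>

definition iter :: "prog \<Rightarrow> nat \<Rightarrow> symbol list \<Rightarrow> regs \<Rightarrow> regs" where
  "iter P r w \<sigma> = fold (\<lambda>a \<tau>. exec P (\<tau>(r := [a]))) w \<sigma>"

lemma iter_simps [simp]:
  "iter P r [] \<sigma> = \<sigma>"
  "iter P r (a # w) \<sigma> = iter P r w (exec P (\<sigma>(r := [a])))"
  "iter P r (v @ w) \<sigma> = iter P r w (iter P r v \<sigma>)"
  by (simp_all add: iter_def)

lemma exec_Loop: "exec (Loop r P) \<sigma> = (iter P r (\<sigma> r) \<sigma>)(r := \<sigma> r)"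
  by (simp add: iter_def)

declare exec.simps(9) [simp del] exec_Loop [simp]

primrec mods :: "prog \<Rightarrow> nat set" where
  "mods Skip = {}"
| "mods (Push r a) = {r}"
| "mods (Copy s r) = {r}"
| "mods (Pop r) = {r}"
| "mods (Clear r) = {r}"
| "mods (Inc r) = {r}"
| "mods (IfTop r c P Q) = mods P \<union> mods Q"
| "mods (IfSame r s P Q) = mods P \<union> mods Q"
| "mods (Loop r P) = mods P"
| "mods (P ;; Q) = mods P \<union> mods Q"

lemma exec_mods: "r \<notin> mods P \<Longrightarrow> exec P \<sigma> r = \<sigma> r"
proof (induction P arbitrary: \<sigma>)
  case (Loop s P)
  have "iter P s w \<tau> r = \<tau> r" if "r \<noteq> s" for w \<tau>
    using Loop that by (induction w arbitrary: \<tau>) auto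
  then show ?case by simp
qed auto

lemma iter_mods: "s \<notin> mods P \<Longrightarrow> s \<noteq> r \<Longrightarrow> iter P r w \<sigma> s = \<sigma> s"
  by (induction w arbitrary: \<sigma>) (auto simp: exec_mods)

text \<open>\<open>A\<close> contains the registers of the enclosing loops.\<close>

primrec stratified :: "nat \<Rightarrow> (nat \<Rightarrow> nat) \<Rightarrow> nat set \<Rightarrow> prog \<Rightarrow> bool" where
  "stratified k lev A Skip \<longleftrightarrow> True"
| "stratified k lev A (Push r a) \<longleftrightarrow> r < k \<and> (\<forall>s\<in>A. lev s < lev r)"
| "stratified k lev A (Copy s r) \<longleftrightarrow> s < k \<and> r < k \<and> s \<noteq> r \<and> (\<forall>s\<in>A. lev s < lev r)"
| "stratified k lev A (Pop r) \<longleftrightarrow> r < k \<and> r \<notin> A"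
| "stratified k lev A (Clear r) \<longleftrightarrow> r < k \<and> r \<notin> A"
| "stratified k lev A (Inc r) \<longleftrightarrow> r < k \<and> (\<forall>s\<in>A. lev s < lev r)"
| "stratified k lev A (IfTop r c P Q) \<longleftrightarrow> r < k \<and> stratified k lev A P \<and> stratified k lev A Q"
| "stratified k lev A (IfSame r s P Q) \<longleftrightarrow> r < k \<and> s < k \<and> stratified k lev A P \<and> stratified k lev A Q"
| "stratified k lev A (Loop r P) \<longleftrightarrow> r < k \<and> r \<notin> A \<and> stratified k lev (insert r A) P"
| "stratified k lev A (Seq P Q) \<longleftrightarrow> stratified k lev A P \<and> stratified k lev A Q"

text \<open>A push to \<open>r\<close> would require \<open>lev r < lev r\<close>; the other updates
  and the inner loops exclude members of \<open>A\<close> outright. So the body of a loop leaves the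
  register of the loop alone, and the head on its tape can serve as loop counter.\<close>

lemma exec_active: "stratified k lev A P \<Longrightarrow> r \<in> A \<Longrightarrow> exec P \<sigma> r = \<sigma> r"
proof (induction P arbitrary: A \<sigma>)
  case (Loop s P)
  have "iter P s w \<tau> r = \<tau> r" if "r \<noteq> s" for w \<tau>
    using Loop.IH[of "insert s A"] Loop.prems that by (induction w arbitrary: \<tau>) auto
  then show ?case by simp
qed auto

text \<open>If \<open>\<beta> r\<close> bounds the length of \<open>r\<close> throughout, then \<open>pushes \<beta> P r\<close> bounds the number of pushes to \<open>r\<close>.
  By \<open>fits\<close>, what is there initially and all that can be pushed stay within \<open>\<beta>\<close>, so that the
  assumption on \<open>\<beta>\<close> takes care of itself.\<close>

primrec pushes :: "(nat \<Rightarrow> nat) \<Rightarrow> prog \<Rightarrow> nat \<Rightarrow> nat" where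
  "pushes \<beta> Skip r = 0"
| "pushes \<beta> (Push s a) r = (if s = r then 1 else 0)"
| "pushes \<beta> (Copy t s) r = (if s = r then 1 else 0)"
| "pushes \<beta> (Pop s) r = 0"
| "pushes \<beta> (Clear s) r = 0"
| "pushes \<beta> (Inc s) r = (if s = r then 1 else 0)"
| "pushes \<beta> (IfTop s c P Q) r = pushes \<beta> P r + pushes \<beta> Q r"
| "pushes \<beta> (IfSame s t P Q) r = pushes \<beta> P r + pushes \<beta> Q r"
| "pushes \<beta> (Loop s P) r = \<beta> s * pushes \<beta> P r"
| "pushes \<beta> (Seq P Q) r = pushes \<beta> P r + pushes \<beta> Q r"

definition fits :: "(nat \<Rightarrow> nat) \<Rightarrow> prog \<Rightarrow> regs \<Rightarrow> bool" where
  "fits \<beta> P \<sigma> \<longleftrightarrow> (\<forall>r. length (\<sigma> r) + pushes \<beta> P r \<le> \<beta> r)"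

lemma fits_length: "fits \<beta> P \<sigma> \<Longrightarrow> length (\<sigma> r) \<le> \<beta> r"
  unfolding fits_def by (meson add_leD1)

lemma fits_simps:
  "fits \<beta> (IfTop s c P Q) \<sigma> \<Longrightarrow> fits \<beta> P \<sigma>"
  "fits \<beta> (IfTop s c P Q) \<sigma> \<Longrightarrow> fits \<beta> Q \<sigma>"
  "fits \<beta> (IfSame s t P Q) \<sigma> \<Longrightarrow> fits \<beta> P \<sigma>"
  "fits \<beta> (IfSame s t P Q) \<sigma> \<Longrightarrow> fits \<beta> Q \<sigma>"
  "fits \<beta> (Seq P Q) \<sigma> \<Longrightarrow> fits \<beta> P \<sigma>"
  unfolding fits_def by (simp; metis add.assoc add_leD1 add.commute)+

text \<open>The two claims support each other along the prefixes of the word: \<open>fits\<close>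
  before a pass lets \<open>len\<close> bound the growth in it, and the accumulated bound leaves
  room for one more pass, as \<open>u\<close> is shorter than \<open>\<sigma> s\<close>. The
  register \<open>s\<close> is excluded from the first claim because it does not hold its own word
  between passes.\<close>

lemma fits_loop_aux:
  assumes len: "\<And>\<tau> r. fits \<beta> P \<tau> \<Longrightarrow> length (exec P \<tau> r) \<le> length (\<tau> r) + pushes \<beta> P r"
    and fits: "fits \<beta> (Loop s P) \<sigma>"
  shows "length u \<le> length (\<sigma> s) \<Longrightarrow> r \<noteq> s \<Longrightarrow>
      length (iter P s u \<sigma> r) \<le> length (\<sigma> r) + length u * pushes \<beta> P r"
    and "length u < length (\<sigma> s) \<Longrightarrow>
      fits \<beta> P ((iter P s u \<sigma>)(s := [a]))"
proof (induction u arbitrary: r a rule: rev_induct)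
  case Nil
  {
    case 1
    then show ?case by simp
  next
    case 2
    show ?case
      unfolding fits_def
    proof
      fix r
      have "length (\<sigma> r) + \<beta> s * pushes \<beta> P r \<le> \<beta> r"
        using fits by (simp add: fits_def)
      moreover have "1 \<le> \<beta> s" and n: "1 \<le> length (\<sigma> s)"
        using 2 fits_length[OF fits, of s] by (cases "\<sigma> s"; auto)+
      then have "pushes \<beta> P r \<le> \<beta> s * pushes \<beta> P r"
        by (metis mult_le_mono1 nat_mult_1)
      ultimately have "length (\<sigma> r) + pushes \<beta> P r \<le> \<beta> r"
        by linarith
      with n have "(if r = s then 1 else length (\<sigma> r)) + pushes \<beta> P r \<le> \<beta> r"
        by (cases "r = s") auto
      then show "length (((iter P s [] \<sigma>)(s := [a])) r)
          + pushes \<beta> P r \<le> \<beta> r"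
        by (simp split: if_splits)
    qed
  }
next
  case (snoc x u)
  let ?\<tau> = "iter P s u \<sigma>"
  have step: "length (iter P s (u @ [x]) \<sigma> r)
      \<le> length (\<sigma> r) + length (u @ [x]) * pushes \<beta> P r"
    if "length (u @ [x]) \<le> length (\<sigma> s)" "r \<noteq> s" for r
  proof -
    have "fits \<beta> P (?\<tau>(s := [x]))"
      using that by (intro snoc.IH(2)) simp
    from len[OF this, of r] that
    have "length (exec P (?\<tau>(s := [x])) r) \<le> length (?\<tau> r) + pushes \<beta> P r"
      by simp
    also have "length (?\<tau> r) \<le> length (\<sigma> r) + length u * pushes \<beta> P r"
      using that by (intro snoc.IH(1)) auto
    finally show ?thesis by simp
  qed
  {
    case 1
    then show ?case by (rule step)
  next
    case 2
    show ?case
      unfolding fits_def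
    proof
      fix r
      have f: "length (\<sigma> r) + \<beta> s * pushes \<beta> P r \<le> \<beta> r"
        using fits by (simp add: fits_def)
      have "Suc (length (u @ [x])) \<le> \<beta> s"
        using 2 fits_length[OF fits, of s] by simp
      then have m: "Suc (length (u @ [x])) * pushes \<beta> P r \<le> \<beta> s * pushes \<beta> P r"
        by (rule mult_right_mono) simp
      show "length (((iter P s (u @ [x]) \<sigma>)(s := [a])) r)
          + pushes \<beta> P r \<le> \<beta> r"
      proof (cases "r = s")
        case True
        then show ?thesis using f m 2 by simp
      next
        case False
        then show ?thesis using f m step[of r] 2 by simp
      qed
    qed
  }
qed

lemma exec_length: "fits \<beta> P \<sigma> \<Longrightarrow> length (exec P \<sigma> r) \<le> length (\<sigma> r) + pushes \<beta> P r"
proof (induction P arbitrary: \<sigma> r)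
  case (Inc s)
  then show ?case by (auto simp: length_inc)
next
  case (IfTop s c P Q)
  then have "fits \<beta> P \<sigma>" "fits \<beta> Q \<sigma>"
    by (auto dest: fits_simps)
  with IfTop.IH[of \<sigma> r] show ?case by auto
next
  case (IfSame s t P Q)
  then have "fits \<beta> P \<sigma>" "fits \<beta> Q \<sigma>"
    by (auto dest: fits_simps)
  with IfSame.IH[of \<sigma> r] show ?case by auto
next
  case (Loop s P)
  have "length (iter P s (\<sigma> s) \<sigma> r)
      \<le> length (\<sigma> r) + length (\<sigma> s) * pushes \<beta> P r" if "r \<noteq> s"
    using fits_loop_aux(1)[OF Loop.IH Loop.prems] that by simp
  moreover have "length (\<sigma> s) * pushes \<beta> P r \<le> \<beta> s * pushes \<beta> P r"
    using fits_length[OF Loop.prems] by (rule mult_right_mono) simp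
  ultimately have "r \<noteq> s \<Longrightarrow> length (iter P s (\<sigma> s) \<sigma> r)
      \<le> length (\<sigma> r) + \<beta> s * pushes \<beta> P r"
    using add_left_mono le_trans by blast
  then show ?case by (cases "r = s") simp_all
next
  case (Seq P Q)
  have fP: "fits \<beta> P \<sigma>"
    using Seq.prems by (rule fits_simps)
  have "fits \<beta> Q (exec P \<sigma>)"
    unfolding fits_def
  proof
    fix r
    have "length (\<sigma> r) + (pushes \<beta> P r + pushes \<beta> Q r) \<le> \<beta> r"
      using Seq.prems by (simp add: fits_def)
    with Seq.IH(1)[OF fP, of r] show "length (exec P \<sigma> r) + pushes \<beta> Q r \<le> \<beta> r" by simp
  qed
  from Seq.IH(1)[OF fP, of r] Seq.IH(2)[OF this, of r] show ?case by simp
qed auto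

lemma fits_Seq2:
  assumes "fits \<beta> (Seq P Q) \<sigma>"
  shows "fits \<beta> Q (exec P \<sigma>)"
  unfolding fits_def
proof
  fix r
  have "length (\<sigma> r) + (pushes \<beta> P r + pushes \<beta> Q r) \<le> \<beta> r"
    using assms by (simp add: fits_def)
  with exec_length[OF fits_simps(5)[OF assms], of r]
  show "length (exec P \<sigma> r) + pushes \<beta> Q r \<le> \<beta> r" by simp
qed

lemma fits_Loop:
  assumes "fits \<beta> (Loop s P) \<sigma>" "length u < length (\<sigma> s)"
  shows "fits \<beta> P ((iter P s u \<sigma>)(s := [a]))"
  using fits_loop_aux(2)[OF exec_length assms] .

section \<open>Turing machines from programs\<close>

text \<open>The word \<open>u\<close> is to the left of the head, and \<open>v\<close> starts under it.\<close>

fun holds :: "'s list \<Rightarrow> 's list \<Rightarrow> 's tape \<Rightarrow> bool" where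
  "holds u v (Tape ls a rs) \<longleftrightarrow>
     (\<exists>m. ls = map Some (rev u) @ replicate m None) \<and> (\<exists>n. a # rs = map Some v @ replicate n None)"

lemma Cons_eq_replicate: "a # w = replicate n x \<longleftrightarrow> (\<exists>m. n = Suc m \<and> a = x \<and> w = replicate m x)"
  by (cases n) auto

lemma holds_read: "holds u v t \<Longrightarrow> read_tape t = peek v"
  by (cases t; cases v) (auto simp: Cons_eq_replicate)

lemma holds_right:
  assumes "holds u (x # v) t"
  shows "holds (u @ [x]) v (move_tape MRight t)"
proof (cases t)
  case (Tape ls a rs)
  with assms have "holds u (x # v) (Tape ls a rs)" by simp
  then show ?thesis unfolding Tape
    by (cases rs) (auto simp: Cons_eq_replicate intro: exI[of _ "Suc 0"])
qed

lemma holds_left: "holds (u @ [x]) v t \<Longrightarrow> holds u (x # v) (move_tape MLeft t)"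
  by (cases t) auto

text \<open>A rewinding head needs no end marker: the cell to the left of a word is blank, and
  stepping back from it restores the situation.\<close>

lemma holds_left_blank:
  assumes "holds [] v t"
  shows "read_tape (move_tape MLeft t) = None"
    and "holds [] v (move_tape MRight (move_tape MLeft t))"
proof -
  obtain ls a rs where t: "t = Tape ls a rs" by (cases t)
  with assms show "read_tape (move_tape MLeft t) = None"
    by (cases ls) (auto simp: Cons_eq_replicate)
  from t assms show "holds [] v (move_tape MRight (move_tape MLeft t))"
    by (cases ls) (auto simp: Cons_eq_replicate intro: exI[of _ "Suc 0"])
qed

lemma holds_write: "holds u v t \<Longrightarrow> holds u (x # tl v) (write_tape (Some x) t)"
  by (cases t; cases v) (auto simp: Cons_eq_replicate)

text \<open>The erased cell joins the blanks on the left, so the start of the word drifts to the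
  right. This is why \<open>holds\<close> admits any number of blanks there.\<close>

lemma holds_pop: "holds [] v t \<Longrightarrow> holds [] (tl v) (move_tape MRight (write_tape None t))"
proof (cases t)
  case (Tape ls a rs)
  assume h: "holds [] v t"
  obtain m where m: "ls = replicate m None" using h Tape by auto
  have "\<exists>n. rs = map Some (tl v) @ replicate n None"
    using h Tape by (cases v) (auto simp: Cons_eq_replicate)
  then show ?thesis using m Tape
    by (cases rs) (auto simp: Cons_eq_replicate intro: exI[of _ "Suc m"] exI[of _ "Suc 0"])
qed

lemma write_read [simp]: "write_tape (read_tape t) t = t"
  by (cases t) auto

lemma output_word_holds: "holds u v t \<Longrightarrow> output_word t = v"
proof (cases t)
  case (Tape ls a rs)
  assume "holds u v t"
  then obtain n where "a # rs = map Some v @ replicate n None" using Tape by auto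
  moreover have "takeWhile (\<lambda>c. c \<noteq> None) (map Some v @ replicate n None) = map Some v"
    by (induction v) (auto simp: takeWhile_eq_Nil_iff)
  ultimately show ?thesis using Tape by (simp add: comp_def del: takeWhile.simps)
qed

lemma holds_input: "holds [] w (input_tape w)"
  by (cases w) (auto intro: exI[of _ 0] exI[of _ "Suc 0"])

section \<open>Machines given by instruction lists\<close>

type_synonym instr = "symbol option list \<Rightarrow> nat \<times> nat \<times> symbol option \<times> move"

text \<open>The position behind the last instruction is the halting state, so a program halts by
  running off its end. \<open>min\<close> makes every instruction list a well-formed machine. Tapes
  other than \<open>r\<close> are rewritten with what was read.\<close>

definition machine :: "nat \<Rightarrow> instr list \<Rightarrow> symbol tm" where
  "machine k C =
     \<lparr>num_states = Suc (length C), num_tapes = k, start_state = 0, halt_state = length C,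
      transition = (\<lambda>q cs. if q < length C
        then case (C ! q) cs of (q', r, b, m) \<Rightarrow>
          (min q' (length C), map (\<lambda>i. if i = r then (b, m) else (cs ! i, MStay)) [0..<k])
        else (length C, map (\<lambda>i. (cs ! i, MStay)) [0..<k]))\<rparr>"

lemma turing_machine_machine: "2 \<le> k \<Longrightarrow> turing_machine (machine k C)"
  by (auto simp: turing_machine_def machine_def split: prod.splits)

lemma machine_step:
  assumes "q < length C" "length ts = k"
    and "(C ! q) (map read_tape ts) = (q', r, b, m)" "q' \<le> length C" "r < k"
  shows "tm_step (machine k C) (q, ts) = (q', ts[r := move_tape m (write_tape b (ts ! r))])"
proof -
  have "map2 (\<lambda>(b, m) t. move_tape m (write_tape b t))
      (map (\<lambda>i. if i = r then (b, m) else (map read_tape ts ! i, MStay)) [0..<k]) ts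
    = ts[r := move_tape m (write_tape b (ts ! r))]"
    using assms by (intro nth_equalityI) (auto simp: nth_list_update)
  with assms show ?thesis by (simp add: machine_def)
qed

definition runs :: "nat \<Rightarrow> instr list \<Rightarrow> nat \<Rightarrow> nat \<times> symbol tape list \<Rightarrow> nat \<times> symbol tape list \<Rightarrow> bool"
  where "runs k C T c c' \<longleftrightarrow> (\<exists>t\<le>T. (tm_step (machine k C) ^^ t) c = c')"

lemma runs_refl: "runs k C T c c"
  unfolding runs_def by (auto intro: exI[of _ 0])

lemma runs_trans: "runs k C T c c' \<Longrightarrow> runs k C T' c' c'' \<Longrightarrow> T + T' \<le> U \<Longrightarrow> runs k C U c c''"
proof -
  assume "runs k C T c c'" "runs k C T' c' c''" and U: "T + T' \<le> U"
  then obtain t t' where "t \<le> T" "(tm_step (machine k C) ^^ t) c = c'"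
    "t' \<le> T'" "(tm_step (machine k C) ^^ t') c' = c''" by (auto simp: runs_def)
  with U show "runs k C U c c''"
    unfolding runs_def by (intro exI[of _ "t' + t"]) (simp add: funpow_add)
qed

lemma runs_mono: "runs k C T c c' \<Longrightarrow> T \<le> U \<Longrightarrow> runs k C U c c'"
  by (rule runs_trans[OF _ runs_refl[of _ _ 0]]) auto

lemma runs_step:
  assumes "q < length C" "length ts = k"
    and "(C ! q) (map read_tape ts) = (q', r, b, m)" "q' \<le> length C" "r < k"
    and "runs k C T (q', ts[r := move_tape m (write_tape b (ts ! r))]) c" "Suc T \<le> U"
  shows "runs k C U (q, ts) c"
proof -
  have "runs k C 1 (q, ts) (q', ts[r := move_tape m (write_tape b (ts ! r))])"
    unfolding runs_def using machine_step[OF assms(1-5)] by (intro exI[of _ 1]) simp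
  from runs_trans[OF this assms(6)] assms(7) show ?thesis by simp
qed

definition scan_instr :: "nat \<Rightarrow> nat \<Rightarrow> instr" where
  "scan_instr n r = (\<lambda>cs. if cs ! r = None then (Suc n, r, None, MStay) else (n, r, cs ! r, MRight))"

definition back_instr :: "nat \<Rightarrow> nat \<Rightarrow> instr" where
  "back_instr n r = (\<lambda>cs. if cs ! r = None then (Suc n, r, None, MRight) else (n, r, cs ! r, MLeft))"

lemma runs_scan:
  assumes "C ! n = scan_instr n r" "n < length C" "length ts = k" "r < k" "holds u v (ts ! r)"
  shows "\<exists>t. holds (u @ v) [] t \<and> runs k C (Suc (length v)) (n, ts) (Suc n, ts[r := t])"
  using assms(3,5)
proof (induction v arbitrary: u ts)
  case Nil
  then have r: "read_tape (ts ! r) = None" by (simp add: holds_read)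
  have w: "write_tape None (ts ! r) = ts ! r" using write_read[of "ts ! r"] r by simp
  have "runs k C (Suc 0) (n, ts) (Suc n, ts[r := ts ! r])"
    by (rule runs_step[OF assms(2) Nil(1), where T = 0 and q' = "Suc n" and r = r
          and b = None and m = MStay])
       (use assms Nil r w in \<open>auto simp: scan_instr_def runs_refl\<close>)
  with Nil show ?case by auto
next
  case (Cons x v)
  then have r: "read_tape (ts ! r) = Some x" by (simp add: holds_read)
  have w: "write_tape (Some x) (ts ! r) = ts ! r" using write_read[of "ts ! r"] r by simp
  let ?ts = "ts[r := move_tape MRight (ts ! r)]"
  have "holds (u @ [x]) v (?ts ! r)"
    using Cons.prems assms(4) by (simp add: holds_right)
  from Cons.IH[OF _ this] Cons.prems obtain t where
    t: "holds (u @ x # v) [] t" "runs k C (Suc (length v)) (n, ?ts) (Suc n, ts[r := t])" by auto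
  have "runs k C (Suc (length (x # v))) (n, ts) (Suc n, ts[r := t])"
    by (rule runs_step[OF assms(2) Cons.prems(1), where T = "Suc (length v)" and q' = n and r = r
          and b = "Some x" and m = MRight])
       (use assms Cons.prems r w t in \<open>auto simp: scan_instr_def\<close>)
  with t(1) show ?case by blast
qed

text \<open>The start is one cell to the left of where \<open>t\<close> stands, because the
  instruction before the rewind has already made that move.\<close>

lemma runs_back:
  assumes "C ! n = back_instr n r" "n < length C" "length ts = k" "r < k" "holds u v t"
  shows "\<exists>t'. holds [] (u @ v) t' \<and>
    runs k C (Suc (length u)) (n, ts[r := move_tape MLeft t]) (Suc n, ts[r := t'])"
  using assms(5)
proof (induction u arbitrary: v t rule: rev_induct)
  case Nil
  note b = holds_left_blank[OF Nil]
  have w: "write_tape None (move_tape MLeft t) = move_tape MLeft t"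
    using write_read[of "move_tape MLeft t"] b by simp
  have "runs k C (Suc 0) (n, ts[r := move_tape MLeft t])
      (Suc n, ts[r := move_tape MRight (move_tape MLeft t)])"
    by (rule runs_step[OF assms(2), where T = 0 and q' = "Suc n" and r = r
          and b = None and m = MRight])
       (use assms b w in \<open>auto simp: back_instr_def runs_refl\<close>)
  with b show ?case by auto
next
  case (snoc x u)
  let ?t = "move_tape MLeft t"
  have h: "holds u (x # v) ?t" using snoc.prems by (rule holds_left)
  then have r: "read_tape ?t = Some x" by (simp add: holds_read)
  have w: "write_tape (Some x) ?t = ?t" using write_read[of ?t] r by simp
  from snoc.IH[OF h] obtain t' where t': "holds [] (u @ x # v) t'"
    "runs k C (Suc (length u)) (n, ts[r := move_tape MLeft ?t]) (Suc n, ts[r := t'])" by auto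
  have "runs k C (Suc (length (u @ [x]))) (n, ts[r := ?t]) (Suc n, ts[r := t'])"
    by (rule runs_step[OF assms(2), where T = "Suc (length u)" and q' = n and r = r
          and b = "Some x" and m = MLeft])
       (use assms r w t' in \<open>auto simp: back_instr_def\<close>)
  with t'(1) show ?case by auto
qed

section \<open>Compilation of programs and its correctness\<close>

primrec size_of :: "prog \<Rightarrow> nat" where
  "size_of Skip = 0"
| "size_of (Push r a) = 4"
| "size_of (Copy s r) = 4"
| "size_of (Pop r) = 1"
| "size_of (Clear r) = 1"
| "size_of (Inc r) = 2"
| "size_of (IfTop r c P Q) = size_of P + size_of Q + 2"
| "size_of (IfSame r s P Q) = size_of P + size_of Q + 2"
| "size_of (Loop r P) = size_of P + 3"
| "size_of (Seq P Q) = size_of P + size_of Q"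

text \<open>The addresses are absolute: the code of \<open>P\<close> starts at \<open>n\<close> and leaves control at \<open>n + size_of P\<close>.\<close>

primrec compile :: "nat \<Rightarrow> prog \<Rightarrow> instr list" where
  "compile n Skip = []"
| "compile n (Push r a) =
     [scan_instr n r, \<lambda>cs. (n + 2, r, Some a, MRight), \<lambda>cs. (n + 3, r, cs ! r, MLeft), back_instr (n + 3) r]"
| "compile n (Copy s r) =
     [scan_instr n r, \<lambda>cs. (n + 2, r, cs ! s, if cs ! s = None then MStay else MRight),
      \<lambda>cs. (n + 3, r, cs ! r, MLeft), back_instr (n + 3) r]"
| "compile n (Pop r) = [\<lambda>cs. (n + 1, r, None, MRight)]"
| "compile n (Clear r) =
     [\<lambda>cs. if cs ! r = None then (n + 1, r, None, MStay) else (n, r, None, MRight)]"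
| "compile n (Inc r) =
     [\<lambda>cs. if cs ! r = Some S1 then (n, r, Some S0, MRight) else (n + 1, r, Some S1, MLeft),
      back_instr (n + 1) r]"
| "compile n (IfTop r c P Q) =
     (\<lambda>cs. (if cs ! r = c then n + 1 else n + 2 + size_of P, r, cs ! r, MStay)) # compile (n + 1) P @
     (\<lambda>cs. (n + 2 + size_of P + size_of Q, r, cs ! r, MStay)) # compile (n + 2 + size_of P) Q"
| "compile n (IfSame r s P Q) =
     (\<lambda>cs. (if cs ! r = cs ! s then n + 1 else n + 2 + size_of P, r, cs ! r, MStay)) # compile (n + 1) P @
     (\<lambda>cs. (n + 2 + size_of P + size_of Q, r, cs ! r, MStay)) # compile (n + 2 + size_of P) Q"
| "compile n (Loop r P) =
     (\<lambda>cs. if cs ! r = None then (n + 2 + size_of P, r, None, MLeft) else (n + 1, r, cs ! r, MStay)) #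
     compile (n + 1) P @
     [\<lambda>cs. (n, r, cs ! r, MRight), back_instr (n + 2 + size_of P) r]"
| "compile n (Seq P Q) = compile n P @ compile (n + size_of P) Q"

lemma length_compile [simp]: "length (compile n P) = size_of P"
  by (induction P arbitrary: n) auto

definition code_at :: "instr list \<Rightarrow> nat \<Rightarrow> instr list \<Rightarrow> bool" where
  "code_at C n c \<longleftrightarrow> n + length c \<le> length C \<and> (\<forall>i<length c. C ! (n + i) = c ! i)"

lemma code_at_Nil: "code_at C n [] \<longleftrightarrow> n \<le> length C"
  by (simp add: code_at_def)

lemma code_at_Cons: "code_at C n (i # c) \<longleftrightarrow> n < length C \<and> C ! n = i \<and> code_at C (Suc n) c"
  by (auto simp: code_at_def less_Suc_eq_0_disj nth_Cons split: nat.splits)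

lemma code_at_append: "code_at C n (c @ d) \<longleftrightarrow> code_at C n c \<and> code_at C (n + length c) d"
  by (induction c arbitrary: n) (auto simp: code_at_Cons code_at_Nil, auto simp: code_at_def)

text \<open>For a register that is being looped over, \<open>\<sigma>\<close> has only the current symbol; \<open>\<upsilon>\<close> and \<open>\<nu>\<close> supply the
  symbols before and after it.\<close>

definition represents :: "nat \<Rightarrow> regs \<Rightarrow> regs \<Rightarrow> regs \<Rightarrow> symbol tape list \<Rightarrow> bool" where
  "represents k \<upsilon> \<nu> \<sigma> ts \<longleftrightarrow> length ts = k \<and> (\<forall>i<k. holds (\<upsilon> i) (\<sigma> i @ \<nu> i) (ts ! i))"

lemma represents_update:
  "represents k \<upsilon> \<nu> \<sigma> ts \<Longrightarrow> r < k \<Longrightarrow> holds u (v @ w) t \<Longrightarrow>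
    represents k (\<upsilon>(r := u)) (\<nu>(r := w)) (\<sigma>(r := v)) (ts[r := t])"
  by (auto simp: represents_def nth_list_update)

lemma represents_update_inactive:
  "represents k \<upsilon> \<nu> \<sigma> ts \<Longrightarrow> r < k \<Longrightarrow> \<upsilon> r = [] \<Longrightarrow> \<nu> r = [] \<Longrightarrow> holds [] v t \<Longrightarrow>
    represents k \<upsilon> \<nu> (\<sigma>(r := v)) (ts[r := t])"
  by (auto simp: represents_def nth_list_update)

text \<open>The variable stands for a common bound on all register lengths. Conditionals are charged
  for both branches and two jumps; loops for a test and a move per symbol besides the body, and for
  the exit test and the rewind.\<close>

primrec time :: "prog \<Rightarrow> nat poly" where
  "time Skip = 0"
| "time (Push r a) = [:6, 2:]"
| "time (Copy s r) = [:6, 2:]"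
| "time (Pop r) = 1"
| "time (Clear r) = [:1, 1:]"
| "time (Inc r) = [:6, 2:]"
| "time (IfTop r c P Q) = time P + time Q + [:2:]"
| "time (IfSame r s P Q) = time P + time Q + [:2:]"
| "time (Loop r P) = [:0, 1:] * (time P + [:2:]) + [:2, 1:]"
| "time (Seq P Q) = time P + time Q"

lemma poly_6_2: "poly [:6, 2:] (b :: nat) = 6 + 2 * b"
  by simp

text \<open>If \<open>\<sigma> r\<close> were empty and \<open>\<nu> r\<close> not, the head would
  scan a symbol that the register does not show. In the simulation this cannot happen: a register
  being looped over shows a symbol, and any other has nothing after it.\<close>

lemma represents_read:
  assumes "represents k \<upsilon> \<nu> \<sigma> ts" "r < k" "\<sigma> r = [] \<Longrightarrow> \<nu> r = []"
  shows "map read_tape ts ! r = peek (\<sigma> r)"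
  using assms by (cases "\<sigma> r = []") (auto simp: represents_def holds_read peek_append)

text \<open>Common core of \<open>Push\<close> and \<open>Copy\<close>, which differ in the symbol
  \<open>w\<close> to be written. That symbol is determined while the head on \<open>r\<close>
  stands behind the word, hence the hypothesis on tapes where the word of \<open>r\<close> is to the
  left of the head.\<close>

lemma runs_append:
  assumes "code_at C n [scan_instr n r, i, \<lambda>cs. (n + 3, r, cs ! r, MLeft), back_instr (n + 3) r]"
    and i: "\<And>cs. i cs = (n + 2, r, w cs, if w cs = None then MStay else MRight)"
    and represents: "represents k \<upsilon> \<nu> \<sigma> ts" and r: "r < k" "\<upsilon> r = []" "\<nu> r = []"
    and w: "\<And>ts. represents k (\<upsilon>(r := \<sigma> r)) \<nu> (\<sigma>(r := [])) ts \<Longrightarrow> w (map read_tape ts) = peek x"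
    and x: "length x \<le> 1" and b: "length (\<sigma> r) \<le> b"
  shows "\<exists>ts'. runs k C (6 + 2 * b) (n, ts) (n + 4, ts') \<and> represents k \<upsilon> \<nu> (\<sigma>(r := \<sigma> r @ x)) ts'"
proof -
  from assms(1) have len: "n + 4 \<le> length C"
    and C: "C ! n = scan_instr n r" "C ! (n + 1) = i" "C ! (n + 2) = (\<lambda>cs. (n + 3, r, cs ! r, MLeft))"
    "C ! (n + 3) = back_instr (n + 3) r"
    by (auto simp: code_at_Cons code_at_Nil eval_nat_numeral)
  have ts: "length ts = k" "holds [] (\<sigma> r) (ts ! r)"
    using represents r by (auto simp: represents_def)
  obtain t where t: "holds (\<sigma> r) [] t"
    and run1: "runs k C (Suc (length (\<sigma> r))) (n, ts) (n + 1, ts[r := t])"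
    using runs_scan[OF C(1) _ ts(1) r(1) ts(2)] len by auto
  have "represents k (\<upsilon>(r := \<sigma> r)) \<nu> (\<sigma>(r := [])) (ts[r := t])"
    using represents r t by (auto simp: represents_def nth_list_update)
  from w[OF this] have w': "w (map read_tape (ts[r := t])) = peek x" .
  define t2 where "t2 = (case x of [] \<Rightarrow> t | a # _ \<Rightarrow> move_tape MRight (write_tape (Some a) t))"
  have rd: "read_tape t = None" using t by (simp add: holds_read)
  have wr: "write_tape None t = t" using write_read[of t] rd by simp
  have t2: "holds (\<sigma> r @ x) [] t2"
  proof (cases x)
    case Nil
    then show ?thesis using t by (simp add: t2_def)
  next
    case (Cons a y)
    then have "y = []" using x by simp
    then show ?thesis using Cons holds_right[of "\<sigma> r" a "[]"] holds_write[OF t, of a]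
      by (simp add: t2_def)
  qed
  have run2: "runs k C 1 (n + 1, ts[r := t]) (n + 2, ts[r := t2])"
    by (rule runs_step[where T = 0 and q' = "n + 2" and r = r
          and b = "peek x" and m = "if peek x = None then MStay else MRight"])
       (use len C ts r i w' wr in \<open>auto simp: runs_refl t2_def split: list.splits\<close>)
  obtain t3 where t3: "holds [] (\<sigma> r @ x) t3" and
    run4: "runs k C (Suc (length (\<sigma> r @ x))) (n + 3, ts[r := move_tape MLeft t2]) (n + 4, ts[r := t3])"
    using runs_back[OF C(4) _ ts(1) r(1) t2] len by (auto simp: eval_nat_numeral)
  have run3: "runs k C 1 (n + 2, ts[r := t2]) (n + 3, ts[r := move_tape MLeft t2])"
    by (rule runs_step[where T = 0 and q' = "n + 3" and r = r
          and b = "read_tape t2" and m = "MLeft"])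
       (use len C ts r in \<open>auto simp: runs_refl\<close>)
  have "runs k C (6 + 2 * b) (n, ts) (n + 4, ts[r := t3])"
    by (rule runs_trans[OF runs_trans[OF runs_trans[OF run1 run2 order_refl] run3 order_refl] run4])
       (use x b in simp)
  moreover have "represents k \<upsilon> \<nu> (\<sigma>(r := \<sigma> r @ x)) (ts[r := t3])"
    using represents_update_inactive[OF represents r t3] .
  ultimately show ?thesis by blast
qed

lemma runs_clear:
  assumes "code_at C n (compile n (Clear r))" and represents: "represents k \<upsilon> \<nu> \<sigma> ts" and r: "r < k" "\<upsilon> r = []" "\<nu> r = []"
  shows "\<exists>ts'. runs k C (Suc (length (\<sigma> r))) (n, ts) (n + 1, ts') \<and> represents k \<upsilon> \<nu> (\<sigma>(r := [])) ts'"
  using represents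
proof (induction "\<sigma> r" arbitrary: \<sigma> ts)
  case Nil
  have rd: "map read_tape ts ! r = None" using represents_read[OF Nil(2) r(1)] r Nil(1) by simp
  have len: "length ts = k" using Nil by (simp add: represents_def)
  have w: "write_tape None (ts ! r) = ts ! r"
    using write_read[of "ts ! r"] rd len r by (simp del: write_read)
  have "runs k C (Suc 0) (n, ts) (n + 1, ts)"
    by (rule runs_step[where T = 0 and q' = "n + 1" and r = r and b = None and m = MStay])
       (use assms(1) rd len r w in \<open>auto simp: code_at_Cons code_at_Nil runs_refl\<close>)
  moreover have "\<sigma>(r := []) = \<sigma>" using Nil(1) by auto
  ultimately show ?case using Nil by auto
next
  case (Cons x v)
  have rd: "map read_tape ts ! r = Some x"
    using represents_read[OF Cons(3) r(1)] r by (simp add: Cons(2)[symmetric])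
  have len: "length ts = k" using Cons by (simp add: represents_def)
  have h: "holds [] (x # v) (ts ! r)" using Cons(3) r by (auto simp: represents_def Cons(2))
  let ?ts = "ts[r := move_tape MRight (write_tape None (ts ! r))]"
  have "represents k \<upsilon> \<nu> (\<sigma>(r := v)) ?ts"
    using represents_update_inactive[OF Cons(3) r holds_pop[OF h]] by simp
  from Cons(1)[OF _ this] obtain ts' where
    ts': "runs k C (Suc (length v)) (n, ?ts) (n + 1, ts')" "represents k \<upsilon> \<nu> (\<sigma>(r := [])) ts'" by auto
  have "runs k C (Suc (length (\<sigma> r))) (n, ts) (n + 1, ts')"
    by (rule runs_step[where T = "Suc (length v)" and q' = n and r = r and b = None and m = MRight])
       (use assms(1) rd len r ts' Cons(2)[symmetric] in \<open>auto simp: code_at_Cons code_at_Nil runs_refl\<close>)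
  with ts'(2) show ?case by blast
qed

lemma runs_inc_aux:
  assumes C: "code_at C n (compile n (Inc r))" and "length ts = k" "r < k" "holds u v (ts ! r)"
  shows "\<exists>t. holds [] (u @ inc v) t \<and>
    runs k C (length u + 2 * length v + 2) (n, ts) (n + 2, ts[r := t])"
proof -
  have len: "n + 2 \<le> length C" and C1: "C ! n = (\<lambda>cs. if cs ! r = Some S1
        then (n, r, Some S0, MRight) else (n + 1, r, Some S1, MLeft))"
    and C2: "C ! (n + 1) = back_instr (n + 1) r"
    using C by (auto simp: code_at_Cons code_at_Nil eval_nat_numeral)
  have stop: "\<exists>t. holds [] (u @ inc v) t \<and>
      runs k C (length u + 2 * length v + 2) (n, ts) (n + 2, ts[r := t])" if ts: "length ts = k" "holds u v (ts ! r)" and v: "peek v \<noteq> Some S1"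
    for u v :: "symbol list" and ts
  proof -
    let ?t = "write_tape (Some S1) (ts ! r)"
    obtain t where t: "holds [] (u @ S1 # tl v) t"
      "runs k C (Suc (length u)) (n + 1, ts[r := move_tape MLeft ?t]) (n + 2, ts[r := t])"
      using runs_back[OF C2 _ ts(1) assms(3) holds_write[OF ts(2)]] len by auto
    have "runs k C (length u + 2 * length v + 2) (n, ts) (n + 2, ts[r := t])"
      by (rule runs_step[where T = "Suc (length u)" and q' = "n + 1" and r = r
            and b = "Some S1" and m = MLeft])
         (use len C1 assms ts v t in \<open>auto simp: holds_read\<close>)
    moreover have "inc v = S1 # tl v" using v by (cases v) auto
    ultimately show ?thesis using t by auto
  qed
  show ?thesis
    using assms(2,4)
  proof (induction v arbitrary: u ts)
    case Nil
    then show ?case by (intro stop) auto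
  next
    case (Cons x v)
    show ?case
    proof (cases "x = S1")
      case False
      then show ?thesis using Cons.prems by (intro stop) auto
    next
      case True
      let ?t = "move_tape MRight (write_tape (Some S0) (ts ! r))"
      have "holds (u @ [S0]) v (ts[r := ?t] ! r)"
        using holds_right[OF holds_write[OF Cons.prems(2)]] Cons.prems assms(3) by simp
      from Cons.IH[OF _ this] Cons.prems obtain t where t: "holds [] (u @ S0 # inc v) t"
        "runs k C (length (u @ [S0]) + 2 * length v + 2) (n, ts[r := ?t]) (n + 2, ts[r := t])"
        by auto
      have "runs k C (length u + 2 * length (x # v) + 2) (n, ts) (n + 2, ts[r := t])"
        by (rule runs_step[where T = "length (u @ [S0]) + 2 * length v + 2" and q' = n and r = r
              and b = "Some S0" and m = MRight])
           (use len C1 assms(3) Cons.prems t True in \<open>auto simp: holds_read\<close>)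
      with t True show ?thesis by auto
    qed
  qed
qed

text \<open>The position of the head is the loop counter: \<open>u\<close>, \<open>a\<close> and
  \<open>v\<close> are what lies to its left, under it and to its right. By \<open>keep\<close>, the
  body returns the register as it found it, so a move to the right leads to the next pass.\<close>

lemma runs_loop:
  assumes code: "code_at C n (compile n (Loop r P))" and "r < k"
    and body: "\<And>u a v ts. \<sigma> r = u @ a # v \<Longrightarrow>
      represents k (\<upsilon>(r := u)) (\<nu>(r := v)) ((iter P r u \<sigma>)(r := [a])) ts \<Longrightarrow>
      \<exists>ts'. runs k C T (n + 1, ts) (n + 1 + size_of P, ts') \<and>
        represents k (\<upsilon>(r := u)) (\<nu>(r := v)) (exec P ((iter P r u \<sigma>)(r := [a]))) ts'"
    and keep: "\<And>\<tau>. exec P \<tau> r = \<tau> r"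
    and represents: "represents k \<upsilon> \<nu> \<sigma> ts" and r: "\<upsilon> r = []" "\<nu> r = []"
  shows "\<exists>ts'. runs k C (length (\<sigma> r) * (T + 2) + (2 + length (\<sigma> r))) (n, ts)
    (n + size_of (Loop r P), ts') \<and> represents k \<upsilon> \<nu> (exec (Loop r P) \<sigma>) ts'"
proof -
  let ?F = "\<lambda>u. iter P r u \<sigma>"
  let ?m = "size_of P"
  have len: "n + 3 + ?m \<le> length C"
    and C1: "C ! n = (\<lambda>cs. if cs ! r = None then (n + 2 + ?m, r, None, MLeft)
        else (n + 1, r, cs ! r, MStay))"
    and C2: "C ! (n + 1 + ?m) = (\<lambda>cs. (n, r, cs ! r, MRight))"
    and C3: "C ! (n + 2 + ?m) = back_instr (n + 2 + ?m) r"
    using code by (auto simp: code_at_Cons code_at_Nil code_at_append eval_nat_numeral)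
  \<comment> \<open>Control is at the loop test with \<open>u\<close> processed and \<open>v\<close>
    ahead. The final tapes are written as the result of a move to the left, the form from which the
    rewind starts.\<close>
  have iter: "\<exists>ts'. runs k C (length v * (T + 2) + 1) (n, ts)
      (n + 2 + ?m, ts'[r := move_tape MLeft (ts' ! r)]) \<and>
      represents k (\<upsilon>(r := \<sigma> r)) \<nu> ((?F (\<sigma> r))(r := [])) ts'"
    if "\<sigma> r = u @ v" "represents k (\<upsilon>(r := u)) \<nu> ((?F u)(r := v)) ts" for u v ts
    using that
  proof (induction v arbitrary: u ts)
    case Nil
    have ts: "length ts = k" using Nil by (simp add: represents_def)
    have rd: "map read_tape ts ! r = None"
      using represents_read[OF Nil(2) assms(2)] r by simp
    then have w: "write_tape None (ts ! r) = ts ! r"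
      using write_read[of "ts ! r"] ts assms(2) by (simp del: write_read)
    have "runs k C 1 (n, ts) (n + 2 + ?m, ts[r := move_tape MLeft (ts ! r)])"
      by (rule runs_step[where T = 0 and q' = "n + 2 + ?m" and r = r and b = None and m = MLeft])
         (use len C1 assms(2) ts rd w in \<open>auto simp: runs_refl\<close>)
    then show ?case using Nil by auto
  next
    case (Cons a v)
    have ts: "length ts = k" using Cons by (simp add: represents_def)
    have rd: "map read_tape ts ! r = Some a"
      using represents_read[OF Cons(3) assms(2)] r by simp
    then have w: "write_tape (Some a) (ts ! r) = ts ! r"
      using write_read[of "ts ! r"] ts assms(2) by (simp del: write_read)
    have run1: "runs k C 1 (n, ts) (n + 1, ts)"
      by (rule runs_step[where T = 0 and q' = "n + 1" and r = r and b = "Some a" and m = MStay])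
         (use len C1 assms(2) ts rd w in \<open>auto simp: runs_refl\<close>)
    have "represents k (\<upsilon>(r := u)) (\<nu>(r := v)) ((?F u)(r := [a])) ts"
      using Cons(3) r by (auto simp: represents_def)
    note body[OF Cons(2) this]
    moreover have "?F (u @ [a]) = exec P ((?F u)(r := [a]))" by simp
    ultimately obtain ts' where
      run2: "runs k C T (n + 1, ts) (n + 1 + ?m, ts')" and
      represents': "represents k (\<upsilon>(r := u)) (\<nu>(r := v)) (?F (u @ [a])) ts'"
      by metis
    have Fr: "?F (u @ [a]) r = [a]" by (simp add: keep)
    have ts': "length ts' = k" using represents' by (simp add: represents_def)
    have h: "holds u (a # v) (ts' ! r)" using represents' Fr assms(2) by (auto simp: represents_def)
    let ?ts = "ts'[r := move_tape MRight (ts' ! r)]"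
    have run3: "runs k C 1 (n + 1 + ?m, ts') (n, ?ts)"
      by (rule runs_step[where T = 0 and q' = n and r = r and b = "read_tape (ts' ! r)" and m = MRight])
         (use len C2 assms(2) ts' in \<open>auto simp: runs_refl\<close>)
    have "represents k ((\<upsilon>(r := u))(r := u @ [a])) ((\<nu>(r := v))(r := [])) ((?F (u @ [a]))(r := v)) ?ts"
      using holds_right[OF h] by (intro represents_update[OF represents' assms(2)]) simp
    then have rep3: "represents k (\<upsilon>(r := u @ [a])) \<nu> ((?F (u @ [a]))(r := v)) ?ts"
      using r by (simp add: fun_upd_idem)
    have "\<sigma> r = (u @ [a]) @ v" using Cons(2) by simp
    from Cons.IH[OF this rep3] obtain ts2 where
      run4: "runs k C (length v * (T + 2) + 1) (n, ?ts)
        (n + 2 + ?m, ts2[r := move_tape MLeft (ts2 ! r)])" and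
      rep4: "represents k (\<upsilon>(r := \<sigma> r)) \<nu> ((?F (\<sigma> r))(r := [])) ts2" by blast
    have "runs k C (length (a # v) * (T + 2) + 1) (n, ts)
        (n + 2 + ?m, ts2[r := move_tape MLeft (ts2 ! r)])"
      by (rule runs_trans[OF runs_trans[OF runs_trans[OF run1 run2 order_refl] run3 order_refl] run4])
         simp
    with rep4 show ?case by blast
  qed
  have "represents k (\<upsilon>(r := [])) \<nu> ((?F [])(r := \<sigma> r)) ts"
    using represents r by (simp add: fun_upd_idem)
  from iter[OF append_Nil[symmetric] this] obtain ts' where
    run1: "runs k C (length (\<sigma> r) * (T + 2) + 1) (n, ts)
      (n + 2 + ?m, ts'[r := move_tape MLeft (ts' ! r)])" and
    rep1: "represents k (\<upsilon>(r := \<sigma> r)) \<nu> ((?F (\<sigma> r))(r := [])) ts'" by blast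
  have ts': "length ts' = k" "holds (\<sigma> r) [] (ts' ! r)"
    using rep1 assms(2) r by (auto simp: represents_def)
  obtain t where t: "holds [] (\<sigma> r) t" and
    run2: "runs k C (Suc (length (\<sigma> r))) (n + 2 + ?m, ts'[r := move_tape MLeft (ts' ! r)])
      (n + 3 + ?m, ts'[r := t])"
    using runs_back[OF C3 _ ts'(1) assms(2) ts'(2)] len by (auto simp: eval_nat_numeral)
  have "represents k ((\<upsilon>(r := \<sigma> r))(r := [])) (\<nu>(r := [])) (((?F (\<sigma> r))(r := []))(r := \<sigma> r)) (ts'[r := t])"
    using t by (intro represents_update[OF rep1 assms(2)]) simp
  then have "represents k \<upsilon> \<nu> (exec (Loop r P) \<sigma>) (ts'[r := t])"
    using r by (simp add: fun_upd_idem)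
  moreover have "runs k C (length (\<sigma> r) * (T + 2) + (2 + length (\<sigma> r))) (n, ts)
    (n + size_of (Loop r P), ts'[r := t])"
    using runs_trans[OF run1 run2 order_refl] by (simp add: algebra_simps eval_nat_numeral)
  ultimately show ?thesis by blast
qed

text \<open>The last two hypotheses are the invariant that separates running loops from the rest:
  the registers in \<open>A\<close> show a symbol, and every other tape has its head at the start of
  its word. \<open>fits\<close> keeps all lengths below \<open>b\<close>, so that every running time
  can be evaluated at this one argument.\<close>

lemma sim:
  assumes "stratified k lev A P" "code_at C n (compile n P)" "fits \<beta> P \<sigma>" "\<And>r. \<beta> r \<le> b" "represents k \<upsilon> \<nu> \<sigma> ts"
    and "\<And>r. r \<in> A \<Longrightarrow> \<sigma> r \<noteq> []" "\<And>r. r \<notin> A \<Longrightarrow> \<upsilon> r = [] \<and> \<nu> r = []"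
  shows "\<exists>ts'. runs k C (poly (time P) b) (n, ts) (n + size_of P, ts') \<and> represents k \<upsilon> \<nu> (exec P \<sigma>) ts'"
  using assms(1-3,5-7)
proof (induction P arbitrary: A n \<sigma> \<upsilon> \<nu> ts)
  case Skip
  then show ?case by (auto intro: runs_refl)
next
  case (Push r a)
  have A: "r \<notin> A" using Push.prems by auto
  have b: "length (\<sigma> r) \<le> b" using fits_length[OF Push.prems(3)] assms(4) le_trans by blast
  have "\<exists>ts'. runs k C (6 + 2 * b) (n, ts) (n + 4, ts') \<and> represents k \<upsilon> \<nu> (\<sigma>(r := \<sigma> r @ [a])) ts'"
    by (rule runs_append[OF Push.prems(2)[unfolded compile.simps] _ Push.prems(4), where w = "\<lambda>_. Some a"])
       (use Push.prems A b in auto)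
  then show ?case by (simp only: exec.simps time.simps size_of.simps poly_6_2)
next
  case (Copy s r)
  have A: "r \<notin> A" using Copy.prems by auto
  have b: "length (\<sigma> r) \<le> b" using fits_length[OF Copy.prems(3)] assms(4) le_trans by blast
  have nu: "\<nu> s = []" if "\<sigma> s = []" using Copy.prems(5,6) that by blast
  have pk: "peek (take 1 (\<sigma> s)) = peek (\<sigma> s)" by (cases "\<sigma> s") auto
  have w: "map read_tape ts ! s = peek (take 1 (\<sigma> s))"
    if "represents k (\<upsilon>(r := \<sigma> r)) \<nu> (\<sigma>(r := [])) ts" for ts
    using represents_read[OF that, of s] Copy.prems(1) nu pk by simp
  have "\<exists>ts'. runs k C (6 + 2 * b) (n, ts) (n + 4, ts') \<and>
      represents k \<upsilon> \<nu> (\<sigma>(r := \<sigma> r @ take 1 (\<sigma> s))) ts'"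
    by (rule runs_append[OF Copy.prems(2)[unfolded compile.simps] _ Copy.prems(4), where w = "\<lambda>cs. cs ! s"])
       (use Copy.prems A b w in \<open>simp_all del: fun_upd_apply\<close>)
  then show ?case by (simp only: exec.simps time.simps size_of.simps poly_6_2)
next
  case (Pop r)
  then have A: "r \<notin> A" "r < k" by auto
  have ts: "length ts = k" "holds [] (\<sigma> r) (ts ! r)" using Pop.prems(4,6) A by (auto simp: represents_def)
  have "runs k C 1 (n, ts) (n + 1, ts[r := move_tape MRight (write_tape None (ts ! r))])"
    by (rule runs_step[where T = 0 and q' = "n + 1" and r = r and b = None and m = MRight])
       (use Pop.prems(2) A ts in \<open>auto simp: runs_refl code_at_Cons code_at_Nil\<close>)
  moreover have "represents k \<upsilon> \<nu> (exec (Pop r) \<sigma>) (ts[r := move_tape MRight (write_tape None (ts ! r))])"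
    unfolding exec.simps using Pop.prems(6)[OF A(1)]
    by (intro represents_update_inactive[OF Pop.prems(4) A(2) _ _ holds_pop[OF ts(2)]]) blast+
  ultimately show ?case by (simp only: time.simps size_of.simps poly_1) blast
next
  case (Clear r)
  have b: "length (\<sigma> r) \<le> b" using fits_length[OF Clear.prems(3)] assms(4) le_trans by blast
  have A: "r \<notin> A" "r < k" using Clear.prems(1) by auto
  obtain ts' where ts': "runs k C (Suc (length (\<sigma> r))) (n, ts) (n + 1, ts')"
    "represents k \<upsilon> \<nu> (\<sigma>(r := [])) ts'"
    using runs_clear[OF Clear.prems(2,4) A(2)] Clear.prems(6)[OF A(1)] by blast
  have "runs k C (poly (time (Clear r)) b) (n, ts) (n + 1, ts')"
    by (rule runs_mono[OF ts'(1)]) (use b in simp)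
  with ts'(2) show ?case by (simp only: exec.simps size_of.simps) blast
next
  case (Inc r)
  have A: "r \<notin> A" "r < k" using Inc.prems by auto
  have b: "length (\<sigma> r) \<le> b" using fits_length[OF Inc.prems(3)] assms(4) le_trans by blast
  have ts: "length ts = k" "holds [] (\<sigma> r) (ts ! r)" using Inc.prems(4,6) A by (auto simp: represents_def)
  from runs_inc_aux[OF Inc.prems(2) ts(1) A(2) ts(2)] obtain t where
    t: "holds [] (inc (\<sigma> r)) t" "runs k C (2 * length (\<sigma> r) + 2) (n, ts) (n + 2, ts[r := t])"
    by (auto simp only: append_Nil list.size add_0)
  from t(2) have "runs k C (6 + 2 * b) (n, ts) (n + 2, ts[r := t])"
    by (rule runs_mono) (use b in simp)
  moreover have "represents k \<upsilon> \<nu> (exec (Inc r) \<sigma>) (ts[r := t])"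
    unfolding exec.simps using Inc.prems(6)[OF A(1)]
    by (intro represents_update_inactive[OF Inc.prems(4) A(2) _ _ t(1)]) blast+
  ultimately show ?case by (simp only: time.simps size_of.simps poly_6_2) blast
next
  case (IfTop r c P Q)
  define T where "T = poly (time P) b + poly (time Q) b + 2"
  let ?c = "peek (\<sigma> r) = c"
  have r: "r < k" and ts: "length ts = k" using IfTop.prems by (auto simp: represents_def)
  have code: "n < length C" "code_at C (n + 1) (compile (n + 1) P)" "n + 1 + size_of P < length C"
    "code_at C (n + 2 + size_of P) (compile (n + 2 + size_of P) Q)" "n + 2 + size_of P + size_of Q \<le> length C"
    and C1: "C ! n = (\<lambda>cs. (if cs ! r = c then n + 1 else n + 2 + size_of P, r, cs ! r, MStay))"
    and C2: "C ! (n + 1 + size_of P) = (\<lambda>cs. (n + 2 + size_of P + size_of Q, r, cs ! r, MStay))"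
    using IfTop.prems(2) by (auto simp: code_at_Cons code_at_append) (auto simp: code_at_def)
  have nu: "\<nu> s = []" if "\<sigma> s = []" for s using IfTop.prems(5,6) that by blast
  have c: "?c \<longleftrightarrow> (let cs = map read_tape ts in cs ! r = c)"
    using IfTop.prems(1) by (simp add: Let_def represents_read[OF IfTop.prems(4) _ nu] del: nth_map)
  have run1: "runs k C 1 (n, ts) (if ?c then n + 1 else n + 2 + size_of P, ts)"
    by (rule runs_step[where T = 0 and q' = "if ?c then n + 1 else n + 2 + size_of P" and r = r
          and b = "read_tape (ts ! r)" and m = MStay])
       (use code(1,3,5) C1 r ts c in \<open>simp_all add: runs_refl Let_def\<close>)
  show ?case
  proof (cases ?c)
    case True
    obtain ts' where ts': "runs k C (poly (time P) b) (n + 1, ts) (n + 1 + size_of P, ts')"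
      "represents k \<upsilon> \<nu> (exec P \<sigma>) ts'"
      using IfTop.IH(1)[OF _ code(2) fits_simps(1)[OF IfTop.prems(3)] IfTop.prems(4-6)] IfTop.prems(1) by auto
    have len: "length ts' = k" using ts'(2) unfolding represents_def by blast
    have run2: "runs k C 1 (n + 1 + size_of P, ts') (n + 2 + size_of P + size_of Q, ts')"
      by (rule runs_step[where T = 0 and q' = "n + 2 + size_of P + size_of Q" and r = r
            and b = "read_tape (ts' ! r)" and m = MStay])
         (use code C2 r len in \<open>simp_all add: runs_refl\<close>)
    have "runs k C 1 (n, ts) (n + 1, ts)" using run1 True by simp
    then have "runs k C T (n, ts) (n + 2 + size_of P + size_of Q, ts')"
      by (rule runs_trans[OF runs_trans[OF _ ts'(1) order_refl] run2]) (simp add: T_def)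
    moreover have "exec (IfTop r c P Q) \<sigma> = exec P \<sigma>" using True by simp
    moreover have "poly (time (IfTop r c P Q)) b = T" by (simp add: T_def)
    moreover have "n + size_of (IfTop r c P Q) = n + 2 + size_of P + size_of Q" by simp
    ultimately show ?thesis using ts'(2) by metis
  next
    case False
    obtain ts' where ts': "runs k C (poly (time Q) b) (n + 2 + size_of P, ts)
        (n + 2 + size_of P + size_of Q, ts')" "represents k \<upsilon> \<nu> (exec Q \<sigma>) ts'"
      using IfTop.IH(2)[OF _ code(4) fits_simps(2)[OF IfTop.prems(3)] IfTop.prems(4-6)] IfTop.prems(1) by auto
    have "runs k C 1 (n, ts) (n + 2 + size_of P, ts)" using run1 False by simp
    then have "runs k C T (n, ts) (n + 2 + size_of P + size_of Q, ts')"
      by (rule runs_trans[OF _ ts'(1)]) (simp add: T_def)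
    moreover have "exec (IfTop r c P Q) \<sigma> = exec Q \<sigma>" using False by simp
    moreover have "poly (time (IfTop r c P Q)) b = T" by (simp add: T_def)
    moreover have "n + size_of (IfTop r c P Q) = n + 2 + size_of P + size_of Q" by simp
    ultimately show ?thesis using ts'(2) by metis
  qed
next
  case (IfSame r s P Q)
  define T where "T = poly (time P) b + poly (time Q) b + 2"
  let ?c = "peek (\<sigma> r) = peek (\<sigma> s)"
  have r: "r < k" and ts: "length ts = k" using IfSame.prems by (auto simp: represents_def)
  have code: "n < length C" "code_at C (n + 1) (compile (n + 1) P)" "n + 1 + size_of P < length C"
    "code_at C (n + 2 + size_of P) (compile (n + 2 + size_of P) Q)" "n + 2 + size_of P + size_of Q \<le> length C"
    and C1: "C ! n = (\<lambda>cs. (if cs ! r = cs ! s then n + 1 else n + 2 + size_of P, r, cs ! r, MStay))"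
    and C2: "C ! (n + 1 + size_of P) = (\<lambda>cs. (n + 2 + size_of P + size_of Q, r, cs ! r, MStay))"
    using IfSame.prems(2) by (auto simp: code_at_Cons code_at_append) (auto simp: code_at_def)
  have nu: "\<nu> s = []" if "\<sigma> s = []" for s using IfSame.prems(5,6) that by blast
  have c: "?c \<longleftrightarrow> (let cs = map read_tape ts in cs ! r = cs ! s)"
    using IfSame.prems(1) by (simp add: Let_def represents_read[OF IfSame.prems(4) _ nu] del: nth_map)
  have run1: "runs k C 1 (n, ts) (if ?c then n + 1 else n + 2 + size_of P, ts)"
    by (rule runs_step[where T = 0 and q' = "if ?c then n + 1 else n + 2 + size_of P" and r = r
          and b = "read_tape (ts ! r)" and m = MStay])
       (use code(1,3,5) C1 r ts c in \<open>simp_all add: runs_refl Let_def\<close>)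
  show ?case
  proof (cases ?c)
    case True
    obtain ts' where ts': "runs k C (poly (time P) b) (n + 1, ts) (n + 1 + size_of P, ts')"
      "represents k \<upsilon> \<nu> (exec P \<sigma>) ts'"
      using IfSame.IH(1)[OF _ code(2) fits_simps(3)[OF IfSame.prems(3)] IfSame.prems(4-6)] IfSame.prems(1) by auto
    have len: "length ts' = k" using ts'(2) unfolding represents_def by blast
    have run2: "runs k C 1 (n + 1 + size_of P, ts') (n + 2 + size_of P + size_of Q, ts')"
      by (rule runs_step[where T = 0 and q' = "n + 2 + size_of P + size_of Q" and r = r
            and b = "read_tape (ts' ! r)" and m = MStay])
         (use code C2 r len in \<open>simp_all add: runs_refl\<close>)
    have "runs k C 1 (n, ts) (n + 1, ts)" using run1 True by simp
    then have "runs k C T (n, ts) (n + 2 + size_of P + size_of Q, ts')"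
      by (rule runs_trans[OF runs_trans[OF _ ts'(1) order_refl] run2]) (simp add: T_def)
    moreover have "exec (IfSame r s P Q) \<sigma> = exec P \<sigma>" using True by simp
    moreover have "poly (time (IfSame r s P Q)) b = T" by (simp add: T_def)
    moreover have "n + size_of (IfSame r s P Q) = n + 2 + size_of P + size_of Q" by simp
    ultimately show ?thesis using ts'(2) by metis
  next
    case False
    obtain ts' where ts': "runs k C (poly (time Q) b) (n + 2 + size_of P, ts)
        (n + 2 + size_of P + size_of Q, ts')" "represents k \<upsilon> \<nu> (exec Q \<sigma>) ts'"
      using IfSame.IH(2)[OF _ code(4) fits_simps(4)[OF IfSame.prems(3)] IfSame.prems(4-6)] IfSame.prems(1) by auto
    have "runs k C 1 (n, ts) (n + 2 + size_of P, ts)" using run1 False by simp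
    then have "runs k C T (n, ts) (n + 2 + size_of P + size_of Q, ts')"
      by (rule runs_trans[OF _ ts'(1)]) (simp add: T_def)
    moreover have "exec (IfSame r s P Q) \<sigma> = exec Q \<sigma>" using False by simp
    moreover have "poly (time (IfSame r s P Q)) b = T" by (simp add: T_def)
    moreover have "n + size_of (IfSame r s P Q) = n + 2 + size_of P + size_of Q" by simp
    ultimately show ?thesis using ts'(2) by metis
  qed
next
  case (Loop r P)
  have r: "r < k" "r \<notin> A" and wf: "stratified k lev (insert r A) P" using Loop.prems by auto
  have b: "length (\<sigma> r) \<le> b" using fits_length[OF Loop.prems(3)] assms(4) le_trans by blast
  have code: "code_at C (n + 1) (compile (n + 1) P)"
    using Loop.prems(2) by (auto simp: code_at_Cons code_at_append)
  have same: "iter P r u \<sigma> s = \<sigma> s" if "s \<in> A" for s u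
  proof -
    have "s \<noteq> r" using that r by auto
    moreover have "iter P r u \<tau> s = \<tau> s" for \<tau>
      using exec_active[OF wf, of s] that \<open>s \<noteq> r\<close> by (induction u arbitrary: \<tau>) auto
    ultimately show ?thesis by simp
  qed
  obtain ts' where ts': "runs k C (length (\<sigma> r) * (poly (time P) b + 2) + (2 + length (\<sigma> r))) (n, ts)
    (n + size_of (Loop r P), ts')" "represents k \<upsilon> \<nu> (exec (Loop r P) \<sigma>) ts'"
  proof (atomize_elim, rule runs_loop[OF Loop.prems(2) r(1) _ _ Loop.prems(4)])
    show "exec P \<tau> r = \<tau> r" for \<tau> using exec_active[OF wf, of r] by simp
    show "\<upsilon> r = []" "\<nu> r = []" using Loop.prems(6) r by auto
  next
    fix u a v ts
    assume u: "\<sigma> r = u @ a # v"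
      and represents: "represents k (\<upsilon>(r := u)) (\<nu>(r := v)) ((iter P r u \<sigma>)(r := [a])) ts"
    show "\<exists>ts'. runs k C (poly (time P) b) (n + 1, ts) (n + 1 + size_of P, ts') \<and>
        represents k (\<upsilon>(r := u)) (\<nu>(r := v)) (exec P ((iter P r u \<sigma>)(r := [a]))) ts'"
    proof (rule Loop.IH[OF wf code _ represents])
      show "fits \<beta> P ((iter P r u \<sigma>)(r := [a]))"
        using u by (intro fits_Loop[OF Loop.prems(3)]) simp
      show "((iter P r u \<sigma>)(r := [a])) s \<noteq> []" if "s \<in> insert r A" for s
        using that same Loop.prems(5) by auto
      show "(\<upsilon>(r := u)) s = [] \<and> (\<nu>(r := v)) s = []" if "s \<notin> insert r A" for s
        using that Loop.prems(6) by auto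
    qed
  qed
  have "length (\<sigma> r) * (poly (time P) b + 2) \<le> b * (poly (time P) b + 2)"
    using b by (rule mult_right_mono) simp
  then have "length (\<sigma> r) * (poly (time P) b + 2) + (2 + length (\<sigma> r)) \<le> poly (time (Loop r P)) b"
    using b by simp
  with ts' show ?case using runs_mono by blast
next
  case (Seq P Q)
  have wf: "stratified k lev A P" "stratified k lev A Q" using Seq.prems by auto
  have code: "code_at C n (compile n P)" "code_at C (n + size_of P) (compile (n + size_of P) Q)"
    using Seq.prems(2) by (auto simp: code_at_append)
  obtain ts1 where ts1: "runs k C (poly (time P) b) (n, ts) (n + size_of P, ts1)"
    "represents k \<upsilon> \<nu> (exec P \<sigma>) ts1"
    using Seq.IH(1)[OF wf(1) code(1) fits_simps(5)[OF Seq.prems(3)] Seq.prems(4-6)] by blast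
  have "exec P \<sigma> r \<noteq> []" if "r \<in> A" for r
    using Seq.prems(5) exec_active[OF wf(1)] that by simp
  then obtain ts2 where ts2:
    "runs k C (poly (time Q) b) (n + size_of P, ts1) (n + size_of P + size_of Q, ts2)"
    "represents k \<upsilon> \<nu> (exec Q (exec P \<sigma>)) ts2"
    using Seq.IH(2)[OF wf(2) code(2) fits_Seq2[OF Seq.prems(3)] ts1(2) _ Seq.prems(6)] by blast
  have "runs k C (poly (time P) b + poly (time Q) b) (n, ts) (n + size_of P + size_of Q, ts2)"
    using runs_trans[OF ts1(1) ts2(1) order_refl] .
  with ts2(2) show ?case by (simp only: exec.simps time.simps size_of.simps poly_add add.assoc) blast
qed

section \<open>Polynomial bounds from the levels\<close>

primrec growth :: "prog \<Rightarrow> nat poly" where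
  "growth Skip = 0"
| "growth (Push r a) = 1"
| "growth (Copy s r) = 1"
| "growth (Pop r) = 0"
| "growth (Clear r) = 0"
| "growth (Inc r) = 1"
| "growth (IfTop r c P Q) = growth P + growth Q"
| "growth (IfSame r s P Q) = growth P + growth Q"
| "growth (Loop r P) = [:0, 1:] * growth P"
| "growth (Seq P Q) = growth P + growth Q"

lemma pushes_eq_0: "stratified k lev A P \<Longrightarrow> s \<in> A \<Longrightarrow> lev r \<le> lev s \<Longrightarrow> pushes \<beta> P r = 0"
proof (induction P arbitrary: A)
  case (Loop t P)
  then show ?case by (metis insertCI mult_0_right pushes.simps(9) stratified.simps(9))
qed (auto dest: leD)

text \<open>\<open>growth\<close> is \<open>pushes\<close> with one variable for all loop lengths.
  It suffices that \<open>c\<close> bounds the registers below the level of \<open>r\<close>: a loop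
  over any other register contains no push to \<open>r\<close>, so its length is multiplied by
  zero.\<close>

lemma pushes_le_growth:
  assumes "\<And>s. lev s < lev r \<Longrightarrow> \<beta> s \<le> c"
  shows "stratified k lev A P \<Longrightarrow> pushes \<beta> P r \<le> poly (growth P) c"
proof (induction P arbitrary: A)
  case (Loop s P)
  then have IH: "pushes \<beta> P r \<le> poly (growth P) c" by auto
  show ?case
  proof (cases "lev s < lev r")
    case True
    then show ?thesis using mult_mono[OF assms[OF True] IH] by simp
  next
    case False
    then have "pushes \<beta> P r = 0"
      using Loop.prems by (intro pushes_eq_0[of k lev "insert s A" P s]) auto
    then show ?thesis by simp
  qed
next
  case (IfTop s c P Q)
  then show ?case by (auto intro: add_mono)
next
  case (IfSame s t P Q)
  then show ?case by (auto intro: add_mono)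
next
  case (Seq P Q)
  then show ?case by (auto intro: add_mono)
qed auto

text \<open>\<open>space P l\<close> bounds the length of the registers of level at most \<open>l\<close>. Pushes to level \<open>Suc l\<close> occur only
  in loops over registers of level at most \<open>l\<close>.\<close>

fun space :: "prog \<Rightarrow> nat \<Rightarrow> nat poly" where
  "space P 0 = [:0, 1:] + growth P"
| "space P (Suc l) = [:0, 1:] + space P l + growth P \<circ>\<^sub>p space P l"

lemma space_mono: "l \<le> l' \<Longrightarrow> poly (space P l) n \<le> poly (space P l') n"
  by (induction l' rule: dec_induct) auto

theorem polynomial_time:
  assumes "stratified k lev {} P" "2 \<le> k" "\<And>r. lev r \<le> L"
  shows "\<exists>(M :: symbol tm) p. turing_machine M \<and>
    (\<forall>x. computes_within M x (poly p (length x)) (exec P ((\<lambda>_. [])(0 := x)) 1))"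
proof (intro exI conjI allI)
  let ?C = "compile 0 P"
  show "turing_machine (machine k ?C)"
    using assms(2) by (rule turing_machine_machine)
  fix x :: "symbol list"
  let ?n = "length x" and ?\<sigma> = "(\<lambda>_. [])(0 := x) :: regs"
  let ?\<beta> = "\<lambda>r. poly (space P (lev r)) ?n"
  have "fits ?\<beta> P ?\<sigma>"
    unfolding fits_def
  proof
    fix r
    have "length (?\<sigma> r) \<le> ?n" by simp
    moreover have "?n + pushes ?\<beta> P r \<le> ?\<beta> r"
    proof (cases "lev r")
      case 0
      then show ?thesis using pushes_le_growth[OF _ assms(1), where r = r and \<beta> = ?\<beta> and c = ?n] by simp
    next
      case (Suc l)
      then have "?\<beta> s \<le> poly (space P l) ?n" if "lev s < lev r" for s
        using that by (intro space_mono) simp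
      from pushes_le_growth[OF _ assms(1), where r = r and \<beta> = ?\<beta>, OF this] Suc show ?thesis
        by (simp add: poly_pcompose)
    qed
    ultimately show "length (?\<sigma> r) + pushes ?\<beta> P r \<le> ?\<beta> r" by linarith
  qed
  moreover have "?\<beta> r \<le> poly (space P L) ?n" for r
    using assms(3) by (intro space_mono)
  moreover have "represents k (\<lambda>_. []) (\<lambda>_. []) ?\<sigma> (snd (tm_init (machine k ?C) x))"
    using assms(2) holds_input
    by (auto simp: represents_def tm_init_def machine_def nth_Cons simp del: input_tape.simps split: nat.splits)
  moreover have "code_at ?C 0 ?C" by (simp add: code_at_def)
  ultimately obtain ts where
    ts: "runs k ?C (poly (time P) (poly (space P L) ?n)) (0, snd (tm_init (machine k ?C) x)) (size_of P, ts)"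
      "represents k (\<lambda>_. []) (\<lambda>_. []) (exec P ?\<sigma>) ts"
    using sim[OF assms(1), of ?C 0 ?\<beta> ?\<sigma> "poly (space P L) ?n" "\<lambda>_. []" "\<lambda>_. []"
        "snd (tm_init (machine k ?C) x)"] by auto
  define T where "T = poly (time P \<circ>\<^sub>p space P L) ?n"
  from ts(1) obtain t where t: "t \<le> T"
    "(tm_step (machine k ?C) ^^ t) (tm_init (machine k ?C) x) = (size_of P, ts)"
    by (auto simp: runs_def T_def poly_pcompose tm_init_def machine_def)
  have halt: "halt_state (machine k ?C) = size_of P" by (simp add: machine_def)
  \<comment> \<open>A halted configuration is a fixed point, so a run of \<open>t\<close> steps
    extends to exactly \<open>T\<close>.\<close>
  then have "(tm_step (machine k ?C) ^^ d) (size_of P, ts) = (size_of P, ts)" for d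
    by (induction d) auto
  moreover have "T = (T - t) + t" using t(1) by simp
  ultimately have "(tm_step (machine k ?C) ^^ T) (tm_init (machine k ?C) x) = (size_of P, ts)"
    using t(2) by (metis comp_apply funpow_add)
  moreover have "output_word (ts ! 1) = exec P ?\<sigma> 1"
    using ts(2) assms(2) by (intro output_word_holds[of "[]"]) (simp add: represents_def)
  ultimately show "computes_within (machine k ?C) x (poly (time P \<circ>\<^sub>p space P L) ?n) (exec P ?\<sigma> 1)"
    unfolding computes_within_def halt T_def by blast
qed

section \<open>Encodings and membership tests\<close>

declare exec_mods [simp] iter_mods [simp] One_nat_def [simp del]

definition append_reg :: "nat \<Rightarrow> nat \<Rightarrow> prog" where
  "append_reg s r = Loop s (Copy s r)"

lemma mods_append_reg [simp]: "mods (append_reg s r) = {r}"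
  by (simp add: append_reg_def)

lemma exec_append_reg [simp]:
  assumes "s \<noteq> r"
  shows "exec (append_reg s r) \<sigma> = \<sigma>(r := \<sigma> r @ \<sigma> s)"
proof -
  have "iter (Copy s r) s w \<sigma> r = \<sigma> r @ w" for w \<sigma>
    using assms by (induction w arbitrary: \<sigma>) auto
  with assms show ?thesis by (auto simp: append_reg_def fun_eq_iff)
qed

text \<open>The copies \<open>rA\<close>, \<open>rB\<close>, \<open>rC\<close> of the antecedent serve the rounds, the clauses of a round, and printing;
  nested loops cannot share a register. \<open>rDer\<close> lists the derived literals.\<close>

abbreviation (input) "rIn \<equiv> 0 :: nat"
abbreviation (input) "rOut \<equiv> 1 :: nat"
abbreviation (input) "rArrow \<equiv> 2 :: nat"
abbreviation (input) "rGoals \<equiv> 3 :: nat"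
abbreviation (input) "rA \<equiv> 4 :: nat"
abbreviation (input) "rB \<equiv> 5 :: nat"
abbreviation (input) "rC \<equiv> 6 :: nat"
abbreviation (input) "rForm \<equiv> 7 :: nat"
abbreviation (input) "rPrem \<equiv> 8 :: nat"
abbreviation (input) "rItem \<equiv> 9 :: nat"
abbreviation (input) "rDer \<equiv> 10 :: nat"
abbreviation (input) "rWork \<equiv> 11 :: nat"
abbreviation (input) "rFail \<equiv> 12 :: nat"
abbreviation (input) "rFound \<equiv> 13 :: nat"
abbreviation (input) "rRest \<equiv> 14 :: nat"
abbreviation (input) "rClose \<equiv> 15 :: nat"
abbreviation (input) "rLeaf \<equiv> 16 :: nat"
abbreviation (input) "rCuts \<equiv> 17 :: nat"
abbreviation (input) "rGoal \<equiv> 18 :: nat"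
abbreviation (input) "rIndex \<equiv> 19 :: nat"
abbreviation (input) "rBot \<equiv> 20 :: nat"

text \<open>\<open>rWork\<close> has the part of the sought word that is yet to be matched. After a mismatch it ends with a comma,
  which no symbol of an item matches.\<close>

definition mem_step :: "nat \<Rightarrow> prog" where
  "mem_step x = IfTop rDer (Some SComma)
     (IfTop rWork None (Push rFound STop) Skip ;; Clear rWork ;; append_reg x rWork)
     (IfSame rDer rWork (Pop rWork) (Push rWork SComma))"

definition mem :: "nat \<Rightarrow> prog" where
  "mem x = Clear rWork ;; append_reg x rWork ;; Loop rDer (mem_step x)"

lemma mods_mem_step: "mods (mem_step x) = {rWork, rFound}"
  by (auto simp: mem_step_def)

lemma mods_mem [simp]: "mods (mem x) = {rWork, rFound}"
  by (auto simp: mem_def mods_mem_step)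

text \<open>An empty \<open>rWork\<close> at the end means an exact match: an item that is too short
  leaves symbols over, and any other mismatch has put a comma at the end, which no symbol of
  \<open>y\<close> can pop.\<close>

lemma mem_step_item:
  "SComma \<notin> set y \<Longrightarrow> (iter (mem_step x) rDer y \<sigma> rWork = []) = (\<sigma> rWork = y) \<and>
     iter (mem_step x) rDer y \<sigma> rFound = \<sigma> rFound"
proof (induction y arbitrary: \<sigma>)
  case (Cons a y)
  let ?w = "if peek (\<sigma> rWork) = Some a then tl (\<sigma> rWork) else \<sigma> rWork @ [SComma]"
  have "(?w = y) = (\<sigma> rWork = a # y)"
    using Cons.prems by (cases "\<sigma> rWork") auto
  with Cons show ?case
    by (cases "\<sigma> rWork") (auto simp: mem_step_def)
qed simp

lemma mem_step_list:
  assumes "x \<notin> {rWork, rFound, rDer}" "\<And>e. e \<in> set es \<Longrightarrow> SComma \<notin> set e"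
  shows "\<sigma> rWork = \<sigma> x \<Longrightarrow>
    (iter (mem_step x) rDer (concat (map (\<lambda>e. e @ [SComma]) es)) \<sigma> rFound = []) =
      (\<sigma> rFound = [] \<and> \<sigma> x \<notin> set es)"
  using assms(2)
proof (induction es arbitrary: \<sigma>)
  case (Cons e es)
  let ?\<tau> = "iter (mem_step x) rDer e \<sigma>"
  let ?\<tau>' = "exec (mem_step x) (?\<tau>(rDer := [SComma]))"
  have e: "(?\<tau> rWork = []) = (\<sigma> x = e)" "?\<tau> rFound = \<sigma> rFound" "?\<tau> x = \<sigma> x"
    using Cons.prems mem_step_item[of e x \<sigma>] assms(1) by (auto simp: mods_mem_step)
  have "?\<tau>' rWork = \<sigma> x" "?\<tau>' x = \<sigma> x" "(?\<tau>' rFound = []) = (\<sigma> rFound = [] \<and> \<sigma> x \<noteq> e)"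
    using assms(1) e by (auto simp: mem_step_def)
  with Cons.IH[of ?\<tau>'] Cons.prems show ?case by auto
qed simp

text \<open>\<open>rFound\<close> is not reset, so consecutive calls form a disjunction; the
  selection of the goal uses this to ask for \<bottom> or an atom.\<close>

lemma exec_mem:
  assumes "x \<notin> {rWork, rFound, rDer}" "\<And>e. e \<in> set es \<Longrightarrow> SComma \<notin> set e"
    and "\<sigma> rDer = concat (map (\<lambda>e. e @ [SComma]) es)"
  shows "(exec (mem x) \<sigma> rFound = []) = (\<sigma> rFound = [] \<and> \<sigma> x \<notin> set es)"
  using assms by (simp add: mem_def mem_step_list)

section \<open>Texts of antecedents and literals\<close>

definition ctext :: "form list \<Rightarrow> symbol list" where
  "ctext As = concat (map (\<lambda>A. enc_form A @ [SComma]) As)"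

lemma ctext_simps [simp]:
  "ctext [] = []" "ctext (A # As) = enc_form A @ SComma # ctext As" "ctext (As @ Bs) = ctext As @ ctext Bs"
  by (simp_all add: ctext_def)

lemma enc_nat_digits: "set (enc_nat n) \<subseteq> {S0, S1}"
proof (induction n rule: enc_nat.induct)
  case (1 n)
  then show ?case by (subst enc_nat.simps) auto
qed

lemma enc_form_symbols: "SComma \<notin> set (enc_form A)" "SArrow \<notin> set (enc_form A)"
  using enc_nat_digits by (induction A) fastforce+

lemma enc_nat_0 [simp]: "enc_nat 0 = []"
  by (simp add: enc_nat.simps)

lemma inc_enc_nat: "inc (enc_nat n) = enc_nat (Suc n)"
proof (induction n rule: enc_nat.induct)
  case (1 n)
  show ?case
  proof (cases "even n")
    case True
    then have "Suc n div 2 = n div 2" by simp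
    moreover have "n \<noteq> 0 \<Longrightarrow> enc_nat n = S0 # enc_nat (n div 2)"
      using True by (subst enc_nat.simps) simp
    moreover have "enc_nat (Suc n) = S1 # enc_nat (Suc n div 2)"
      using True by (subst enc_nat.simps) simp
    ultimately show ?thesis by (cases "n = 0") auto
  next
    case False
    then have "enc_nat n = S1 # enc_nat (n div 2)" "enc_nat (Suc n) = S0 # enc_nat (Suc (n div 2))"
      by (subst enc_nat.simps; auto elim!: oddE)+
    with 1 False show ?thesis by (cases "n = 0") auto
  qed
qed

lemma enc_nat_inj: "enc_nat m = enc_nat n \<Longrightarrow> m = n"
proof (induction m arbitrary: n rule: enc_nat.induct)
  case (1 m)
  have m: "enc_nat m = (if m = 0 then [] else (if odd m then S1 else S0) # enc_nat (m div 2))"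
    and n: "enc_nat n = (if n = 0 then [] else (if odd n then S1 else S0) # enc_nat (n div 2))"
    by (subst enc_nat.simps, simp)+
  show ?case
  proof (cases "m = 0 \<or> n = 0")
    case True
    with 1 m n show ?thesis by (auto split: if_splits)
  next
    case False
    then have "odd m = odd n" "enc_nat (m div 2) = enc_nat (n div 2)"
      using 1(2) unfolding m n by (auto split: if_splits)
    with 1(1) False have "m mod 2 = n mod 2" "m div 2 = n div 2"
      by (auto simp: odd_iff_mod_2_eq_one)
    then show ?thesis by (metis div_mult_mod_eq)
  qed
qed

definition literal :: "form \<Rightarrow> bool" where
  "literal A \<longleftrightarrow> A = Bot \<or> (\<exists>a. A = Atom a)"

lemma enc_literal_inj: "literal A \<Longrightarrow> literal B \<Longrightarrow> enc_form A = enc_form B \<Longrightarrow> A = B"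
  by (auto simp: literal_def dest: enc_nat_inj)

lemma exec_mem_literal:
  assumes "x \<notin> {rWork, rFound, rDer}" "\<sigma> rDer = ctext es" "\<sigma> x = enc_form A"
    and "literal A" "\<And>e. e \<in> set es \<Longrightarrow> literal e"
  shows "(exec (mem x) \<sigma> rFound = []) = (\<sigma> rFound = [] \<and> A \<notin> set es)"
proof -
  have "(enc_form A \<in> enc_form ` set es) = (A \<in> set es)"
    using assms(4,5) enc_literal_inj by blast
  moreover have "SComma \<notin> set e" if "e \<in> set (map enc_form es)" for e
    using that enc_form_symbols by auto
  ultimately show ?thesis
    using exec_mem[OF assms(1), of "map enc_form es" \<sigma>] assms(2,3)
    by (simp add: ctext_def comp_def image_iff)
qed

section \<open>Printing the derivation of one clause\<close>

definition ctx :: prog where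
  "ctx = append_reg rC rOut ;; append_reg rDer rOut ;; Push rOut SArrow"

lemma mods_ctx [simp]: "mods ctx = {rOut}"
  by (auto simp: ctx_def)

definition ctx_text :: "regs \<Rightarrow> symbol list" where
  "ctx_text \<sigma> = \<sigma> rC @ \<sigma> rDer @ [SArrow]"

lemma exec_ctx [simp]: "exec ctx \<sigma> = \<sigma>(rOut := \<sigma> rOut @ ctx_text \<sigma>)"
  by (simp add: ctx_def ctx_text_def)

lemma ctx_text_cong: "\<sigma> rC = \<tau> rC \<Longrightarrow> \<sigma> rDer = \<tau> rDer \<Longrightarrow> ctx_text \<sigma> = ctx_text \<tau>"
  by (simp add: ctx_text_def)

text \<open>The digits of an atom have no end mark, so the bracket of its leaf is written only when
  the next leaf or node begins. A non-empty \<open>rLeaf\<close> says that such a bracket is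
  owed.\<close>

definition close_leaf :: prog where
  "close_leaf = IfTop rLeaf None Skip (Push rOut SClose ;; Clear rLeaf)"

text \<open>\<open>rRest\<close> runs along with the loop. In Polish notation with bracketing to the
  right, the text from an \<open>SAnd\<close> on is exactly the remaining conjunction, hence the
  succedent of the node opened there. \<open>rClose\<close> gets one bracket per atom: one for the
  last leaf, and the others for the conjunction nodes, which are one fewer than the atoms.\<close>

definition conj_step :: prog where
  "conj_step =
     IfTop rPrem (Some SAnd) (close_leaf ;; Push rOut SOpen ;; ctx ;; append_reg rRest rOut)
       (IfTop rPrem (Some SVar)
          (close_leaf ;; Push rOut SOpen ;; ctx ;; Push rOut SVar ;; Push rLeaf STop ;; Push rClose SClose)
          (Copy rPrem rOut)) ;;
     Pop rRest"

definition emit_conj :: prog where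
  "emit_conj = Clear rRest ;; append_reg rPrem rRest ;; Clear rLeaf ;; Clear rClose ;;
     Loop rPrem conj_step ;; append_reg rClose rOut"

lemma mods_conj_step: "mods conj_step = {rOut, rLeaf, rClose, rRest}"
  by (auto simp: conj_step_def close_leaf_def)

lemma mods_emit_conj [simp]: "mods emit_conj = {rOut, rLeaf, rClose, rRest}"
  by (auto simp: emit_conj_def mods_conj_step)

abbreviation close_text :: "regs \<Rightarrow> symbol list" where
  "close_text \<sigma> \<equiv> (if \<sigma> rLeaf = [] then [] else [SClose])"

lemma conj_step_SAnd:
  fixes \<sigma> :: regs
  defines "\<tau> \<equiv> exec conj_step (\<sigma>(rPrem := [SAnd]))"
  shows "\<tau> rOut = \<sigma> rOut @ close_text \<sigma> @ SOpen # ctx_text \<sigma> @ \<sigma> rRest"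
    "\<tau> rLeaf = []" "\<tau> rClose = \<sigma> rClose" "\<tau> rRest = tl (\<sigma> rRest)"
  by (auto simp: \<tau>_def conj_step_def close_leaf_def ctx_text_def)

lemma conj_step_SVar:
  fixes \<sigma> :: regs
  defines "\<tau> \<equiv> exec conj_step (\<sigma>(rPrem := [SVar]))"
  shows "\<tau> rOut = \<sigma> rOut @ close_text \<sigma> @ SOpen # ctx_text \<sigma> @ [SVar]"
    "\<tau> rLeaf = [STop]" "\<tau> rClose = \<sigma> rClose @ [SClose]" "\<tau> rRest = tl (\<sigma> rRest)"
  by (auto simp: \<tau>_def conj_step_def close_leaf_def ctx_text_def)

lemma conj_step_digit:
  fixes \<sigma> :: regs
  assumes "a \<in> {S0, S1}"
  defines "\<tau> \<equiv> exec conj_step (\<sigma>(rPrem := [a]))"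
  shows "\<tau> rOut = \<sigma> rOut @ [a]"
    "\<tau> rLeaf = \<sigma> rLeaf" "\<tau> rClose = \<sigma> rClose" "\<tau> rRest = tl (\<sigma> rRest)"
  using assms(1) by (auto simp: \<tau>_def conj_step_def close_leaf_def ctx_text_def)

lemma conj_step_digits:
  assumes "set w \<subseteq> {S0, S1}"
  shows "iter conj_step rPrem w \<sigma> rOut = \<sigma> rOut @ w"
    "iter conj_step rPrem w \<sigma> rLeaf = \<sigma> rLeaf"
    "iter conj_step rPrem w \<sigma> rClose = \<sigma> rClose"
    "iter conj_step rPrem w \<sigma> rRest = drop (length w) (\<sigma> rRest)"
  using assms by (induction w arbitrary: \<sigma>) (simp_all add: conj_step_digit drop_Suc)

text \<open>The text of \<open>conj_tree\<close> below, without its trailing brackets.\<close>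

fun conj_text :: "symbol list \<Rightarrow> nat list \<Rightarrow> symbol list" where
  "conj_text c [] = []"
| "conj_text c [q] = SOpen # c @ enc_form (Atom q)"
| "conj_text c (q # q' # Q) = SOpen # c @ enc_form (Conj (map Atom (q # q' # Q))) @
     SOpen # c @ enc_form (Atom q) @ SClose # conj_text c (q' # Q)"

lemma conj_step_Conj:
  assumes "Q \<noteq> []" "\<sigma> rRest = enc_form (Conj (map Atom Q))"
  defines "\<tau> \<equiv> iter conj_step rPrem (enc_form (Conj (map Atom Q))) \<sigma>"
  shows "\<tau> rOut = \<sigma> rOut @ close_text \<sigma> @ conj_text (ctx_text \<sigma>) Q \<and>
    \<tau> rClose = \<sigma> rClose @ replicate (length Q) SClose"
  using assms(1,2) unfolding \<tau>_def
proof (induction "ctx_text \<sigma>" Q arbitrary: \<sigma> rule: conj_text.induct)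
  case (2 q)
  then show ?case by (simp add: conj_step_SVar conj_step_digits enc_nat_digits)
next
  case (3 q q' Q)
  let ?w = "enc_form (Conj (map Atom (q' # Q)))"
  let ?\<tau>1 = "exec conj_step (\<sigma>(rPrem := [SAnd]))"
  let ?\<tau>2 = "exec conj_step (?\<tau>1(rPrem := [SVar]))"
  let ?\<tau> = "iter conj_step rPrem (enc_nat q) ?\<tau>2"
  have ctx1: "ctx_text ?\<tau>1 = ctx_text \<sigma>" by (intro ctx_text_cong) (simp_all add: mods_conj_step)
  have ctx: "ctx_text ?\<tau> = ctx_text \<sigma>" by (intro ctx_text_cong) (simp_all add: mods_conj_step)
  have rest: "?\<tau> rRest = ?w"
    using 3(3) by (simp add: conj_step_SAnd conj_step_SVar conj_step_digits enc_nat_digits)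
  have out: "?\<tau> rOut = \<sigma> rOut @ close_text \<sigma> @ SOpen # ctx_text \<sigma> @
      enc_form (Conj (map Atom (q # q' # Q))) @ SOpen # ctx_text \<sigma> @ enc_form (Atom q)"
    using 3(3) ctx1 by (simp add: conj_step_SAnd conj_step_SVar conj_step_digits enc_nat_digits)
  have oth: "?\<tau> rLeaf = [STop]" "?\<tau> rClose = \<sigma> rClose @ [SClose]"
    by (simp_all add: conj_step_SAnd conj_step_SVar conj_step_digits enc_nat_digits)
  have "iter conj_step rPrem (enc_form (Conj (map Atom (q # q' # Q)))) \<sigma> = iter conj_step rPrem ?w ?\<tau>"
    by simp
  moreover obtain \<theta> where "\<theta> = ?\<tau>" by blast
  ultimately show ?case
    using 3(1)[of \<theta>] ctx rest out oth by simp
qed simp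

lemma exec_emit_conj:
  assumes "Q \<noteq> []" "\<sigma> rPrem = enc_form (Conj (map Atom Q))"
  shows "exec emit_conj \<sigma> rOut = \<sigma> rOut @ conj_text (ctx_text \<sigma>) Q @ replicate (length Q) SClose"
proof -
  let ?\<sigma> = "\<sigma>(rRest := \<sigma> rPrem, rLeaf := [], rClose := [])"
  have "ctx_text ?\<sigma> = ctx_text \<sigma>" by (intro ctx_text_cong) simp_all
  with conj_step_Conj[OF assms(1), of ?\<sigma>] assms(2) show ?thesis
    by (simp add: emit_conj_def)
qed

text \<open>The cut node is left open, since its right premise is the rest of the chain; the bracket
  owed is noted in \<open>rCuts\<close>. The three brackets in a row close the axiom on the head,
  the implication rule and the contraction.\<close>

definition fire :: prog where
  "fire = Push rOut SOpen ;; ctx ;; append_reg rGoal rOut ;;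
     Push rOut SOpen ;; ctx ;; append_reg rItem rOut ;;
     IfTop rPrem None (Push rOut SClose)
       (Push rOut SOpen ;; append_reg rForm rOut ;; Push rOut SComma ;; ctx ;; append_reg rItem rOut ;;
        emit_conj ;;
        Push rOut SOpen ;; append_reg rItem rOut ;; Push rOut SComma ;; ctx ;; append_reg rItem rOut ;;
        Push rOut SClose ;; Push rOut SClose ;; Push rOut SClose) ;;
     append_reg rItem rDer ;; Push rDer SComma ;; Push rCuts SClose"

type_synonym clause = "nat list \<times> form"

fun clause_form :: "clause \<Rightarrow> form" where
  "clause_form (Q, h) = (if Q = [] then h else Imp (Conj (map Atom Q)) h)"

fun conj_tree :: "form list \<Rightarrow> nat list \<Rightarrow> proof_tree" where
  "conj_tree \<Delta> (q # q' # Q) = Node (\<Delta>, Some (Conj (map Atom (q # q' # Q))))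
     [Node (\<Delta>, Some (Atom q)) [], conj_tree \<Delta> (q' # Q)]"
| "conj_tree \<Delta> Q = Node (\<Delta>, Some (Conj (map Atom Q))) []"

text \<open>Read upwards, the contraction duplicates the clause, so the implication rule consumes
  the copy and both its premises keep all of \<open>\<Delta>\<close>. Thus the same context is
  printed everywhere, and the clause never has to be deleted from it.\<close>

fun clause_tree :: "form list \<Rightarrow> clause \<Rightarrow> proof_tree" where
  "clause_tree \<Delta> (Q, h) = Node (\<Delta>, Some h) (if Q = [] then [] else
     [Node (clause_form (Q, h) # \<Delta>, Some h) [conj_tree \<Delta> Q, Node (h # \<Delta>, Some h) []]])"

lemma enc_sequent_ctext: "enc_sequent (\<Delta>, Some A) = ctext \<Delta> @ SArrow # enc_form A"
  by (simp add: ctext_def)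

lemma enc_conj_tree:
  "Q \<noteq> [] \<Longrightarrow> enc_proof (conj_tree \<Delta> Q) = conj_text (ctext \<Delta> @ [SArrow]) Q @ replicate (length Q) SClose"
proof (induction \<Delta> Q rule: conj_tree.induct)
  case (1 \<Delta> q q' Q)
  then show ?case
    by (simp add: enc_sequent_ctext replicate_append_same[symmetric] del: enc_sequent.simps)
qed (simp_all add: enc_sequent_ctext del: enc_sequent.simps)

lemma exec_fire:
  assumes "\<sigma> rForm = enc_form (clause_form (Q, h))" "\<sigma> rItem = enc_form h"
    and "\<sigma> rPrem = (if Q = [] then [] else enc_form (Conj (map Atom Q)))"
    and "\<sigma> rC = ctext \<Gamma>" "\<sigma> rDer = ctext es"
  shows "exec fire \<sigma> rOut = \<sigma> rOut @ SOpen # ctext (\<Gamma> @ es) @ SArrow # \<sigma> rGoal @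
      enc_proof (clause_tree (\<Gamma> @ es) (Q, h))"
    and "exec fire \<sigma> rDer = ctext (es @ [h])"
    and "exec fire \<sigma> rCuts = \<sigma> rCuts @ [SClose]"
proof -
  have ctx: "ctx_text \<tau> = ctext (\<Gamma> @ es) @ [SArrow]" if "\<tau> rC = \<sigma> rC" "\<tau> rDer = \<sigma> rDer" for \<tau>
    using that assms(4,5) by (simp add: ctx_text_def)
  have ne: "Q \<noteq> [] \<Longrightarrow> enc_form (Conj (map Atom Q)) \<noteq> []"
    by (cases "(\<Gamma>, Q)" rule: conj_tree.cases) auto
  show "exec fire \<sigma> rOut = \<sigma> rOut @ SOpen # ctext (\<Gamma> @ es) @ SArrow # \<sigma> rGoal @
      enc_proof (clause_tree (\<Gamma> @ es) (Q, h))"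
  proof (cases "Q = []")
    case True
    then show ?thesis using assms
      by (simp add: fire_def ctx enc_sequent_ctext del: enc_sequent.simps)
  next
    case False
    then show ?thesis using assms ne
      by (simp add: fire_def ctx enc_sequent_ctext exec_emit_conj enc_conj_tree del: enc_sequent.simps)
  qed
  show "exec fire \<sigma> rDer = ctext (es @ [h])" "exec fire \<sigma> rCuts = \<sigma> rCuts @ [SClose]"
    using assms(2,5) by (simp_all add: fire_def)
qed

section \<open>Unit propagation as a program\<close>

text \<open>The last item of a clause is its head, so an item turns out to be a premise only when the next one starts.\<close>

definition flush :: prog where
  "flush = IfTop rItem None Skip
     (Clear rFound ;; mem rItem ;; IfTop rFound None (Push rFail STop) Skip ;;
      append_reg rItem rPrem ;; Clear rItem)"

text \<open>In a clause, a new symbol \<open>SVar\<close>, \<open>SBot\<close> or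
  \<open>SAnd\<close> ends the pending item, while \<open>SImp\<close> is recorded in
  \<open>rForm\<close> alone. As \<open>SAnd\<close> reaches \<open>rPrem\<close> after that item,
  the end of the clause finds the text of the premise in \<open>rPrem\<close> and the head in
  \<open>rItem\<close>.\<close>

definition read_step :: prog where
  "read_step = Copy rB rForm ;;
     IfTop rB (Some SImp) Skip
    (IfTop rB (Some S0) (Copy rB rItem)
    (IfTop rB (Some S1) (Copy rB rItem)
     (flush ;; IfTop rB (Some SAnd) (Copy rB rPrem) (Copy rB rItem))))"

definition clause_step :: prog where
  "clause_step = IfTop rB (Some SComma)
     (IfTop rFail None fire Skip ;; Clear rForm ;; Clear rPrem ;; Clear rItem ;; Clear rFail)
     read_step"

text \<open>The number of rounds is the length of the antecedent as a text, which is at least the number of clauses.\<close>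

definition main :: prog where
  "main = Clear rDer ;; Clear rCuts ;; Clear rForm ;; Clear rPrem ;; Clear rItem ;; Clear rFail ;;
     Loop rA (Loop rB clause_step) ;;
     Push rOut SOpen ;; ctx ;; append_reg rGoal rOut ;; Push rOut SClose ;; append_reg rCuts rOut"

lemma mods_flush [simp]: "mods flush = {rFound, rWork, rFail, rPrem, rItem}"
  by (auto simp: flush_def)

lemma mods_read_step [simp]: "mods read_step = {rFound, rWork, rFail, rPrem, rItem, rForm}"
  by (auto simp: read_step_def)

lemma mods_fire [simp]: "mods fire = {rOut, rLeaf, rClose, rRest, rDer, rCuts}"
  by (auto simp: fire_def)

lemma mods_clause_step [simp]:
  "mods clause_step = {rFound, rWork, rFail, rPrem, rItem, rForm, rOut, rLeaf, rClose, rRest, rDer, rCuts}"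
  by (auto simp: clause_step_def)

lemma mods_main [simp]: "mods main = mods clause_step"
  by (auto simp: main_def)

lemma literal_simps [simp]: "literal (Atom a)" "literal Bot"
  by (auto simp: literal_def)

section \<open>Correctness of reading, firing and the rounds\<close>

lemma iter_clause_step:
  "SComma \<notin> set w \<Longrightarrow> iter clause_step rB w \<sigma> = iter read_step rB w \<sigma>"
  by (induction w arbitrary: \<sigma>) (auto simp: clause_step_def)

text \<open>No item is being read, or the one that is has been derived.\<close>

definition pending :: "symbol list \<Rightarrow> form list \<Rightarrow> bool" where
  "pending x es \<longleftrightarrow> x = [] \<or> (\<exists>A\<in>set es. x = enc_form A)"

lemma exec_flush:
  assumes "\<sigma> rDer = ctext es" "\<And>e. e \<in> set es \<Longrightarrow> literal e" "\<sigma> rItem = [] \<or> (\<exists>A. literal A \<and> \<sigma> rItem = enc_form A)"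
  shows "exec flush \<sigma> rPrem = \<sigma> rPrem @ \<sigma> rItem"
    "exec flush \<sigma> rItem = []"
    "(exec flush \<sigma> rFail = []) = (\<sigma> rFail = [] \<and> pending (\<sigma> rItem) es)"
proof -
  show "exec flush \<sigma> rPrem = \<sigma> rPrem @ \<sigma> rItem" "exec flush \<sigma> rItem = []"
    by (auto simp: flush_def)
  show "(exec flush \<sigma> rFail = []) = (\<sigma> rFail = [] \<and> pending (\<sigma> rItem) es)"
  proof (cases "\<sigma> rItem = []")
    case False
    then obtain A where A: "literal A" "\<sigma> rItem = enc_form A" using assms(3) by blast
    have "(exec (mem rItem) (\<sigma>(rFound := [])) rFound = []) = (A \<notin> set es)"
      using exec_mem_literal[of rItem "\<sigma>(rFound := [])" es A] assms(1,2) A by simp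
    moreover have "pending (\<sigma> rItem) es \<longleftrightarrow> A \<in> set es"
      using A False assms(2) enc_literal_inj by (auto simp: pending_def)
    ultimately show ?thesis using False by (auto simp: flush_def)
  qed (simp add: flush_def pending_def)
qed

lemma read_step_symbol:
  assumes "\<sigma> rDer = ctext es" "\<And>e. e \<in> set es \<Longrightarrow> literal e" "\<sigma> rItem = [] \<or> (\<exists>A. literal A \<and> \<sigma> rItem = enc_form A)"
    and "a \<notin> {SImp, S0, S1}"
  defines "\<tau> \<equiv> exec read_step (\<sigma>(rB := [a]))"
  shows "\<tau> rForm = \<sigma> rForm @ [a]"
    "\<tau> rPrem = \<sigma> rPrem @ \<sigma> rItem @ (if a = SAnd then [SAnd] else [])"
    "\<tau> rItem = (if a = SAnd then [] else [a])"
    "(\<tau> rFail = []) = (\<sigma> rFail = [] \<and> pending (\<sigma> rItem) es)"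
  using assms(4) exec_flush[of "\<sigma>(rB := [a], rForm := \<sigma> rForm @ [a])" es] assms(1-3)
  by (auto simp: \<tau>_def read_step_def)

lemma read_step_digits:
  assumes "set w \<subseteq> {S0, S1}"
  shows "iter read_step rB w \<sigma> rForm = \<sigma> rForm @ w"
    "iter read_step rB w \<sigma> rPrem = \<sigma> rPrem"
    "iter read_step rB w \<sigma> rItem = \<sigma> rItem @ w"
    "iter read_step rB w \<sigma> rFail = \<sigma> rFail"
  using assms by (induction w arbitrary: \<sigma>) (auto simp: read_step_def)

lemma read_step_SImp:
  "exec read_step (\<sigma>(rB := [SImp])) = \<sigma>(rB := [SImp], rForm := \<sigma> rForm @ [SImp])"
  by (auto simp: read_step_def)

lemma read_step_literal:
  assumes "\<sigma> rDer = ctext es" "\<And>e. e \<in> set es \<Longrightarrow> literal e" "\<sigma> rItem = [] \<or> (\<exists>A. literal A \<and> \<sigma> rItem = enc_form A)"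
    and "literal h"
  defines "\<tau> \<equiv> iter read_step rB (enc_form h) \<sigma>"
  shows "\<tau> rForm = \<sigma> rForm @ enc_form h"
    "\<tau> rPrem = \<sigma> rPrem @ \<sigma> rItem"
    "\<tau> rItem = enc_form h"
    "(\<tau> rFail = []) = (\<sigma> rFail = [] \<and> pending (\<sigma> rItem) es)"
  using assms(4) by (auto simp: \<tau>_def literal_def read_step_symbol[OF assms(1-3)]
      read_step_digits[OF enc_nat_digits])

lemma pending_literal:
  assumes "\<And>e. e \<in> set es \<Longrightarrow> literal e" "literal A"
  shows "pending (enc_form A) es \<longleftrightarrow> A \<in> set es"
proof -
  have "enc_form A \<noteq> []" using assms(2) by (auto simp: literal_def)
  then show ?thesis using assms enc_literal_inj by (auto simp: pending_def)
qed

text \<open>The last atom is still pending when the conjunction ends, so the text is spread over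
  \<open>rPrem\<close> and \<open>rItem\<close>, and only the atoms of \<open>butlast Q\<close> have
  been looked up.\<close>

lemma read_step_Conj:
  assumes "Q \<noteq> []" "\<sigma> rDer = ctext es" "\<And>e. e \<in> set es \<Longrightarrow> literal e"
    and "\<sigma> rItem = [] \<or> (\<exists>A. literal A \<and> \<sigma> rItem = enc_form A)"
  defines "\<tau> \<equiv> iter read_step rB (enc_form (Conj (map Atom Q))) \<sigma>"
  shows "\<tau> rForm = \<sigma> rForm @ enc_form (Conj (map Atom Q)) \<and>
    \<tau> rPrem @ \<tau> rItem = \<sigma> rPrem @ \<sigma> rItem @ enc_form (Conj (map Atom Q)) \<and>
    \<tau> rItem = enc_form (Atom (last Q)) \<and>
    (\<tau> rFail = []) = (\<sigma> rFail = [] \<and> pending (\<sigma> rItem) es \<and> Atom ` set (butlast Q) \<subseteq> set es)"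
  using assms(1,2,4) unfolding \<tau>_def
proof (induction Q arbitrary: \<sigma> rule: induct_list012)
  case (2 q)
  then show ?case
    using read_step_literal[OF 2(2) assms(3) 2(3), of "Atom q"] by simp
next
  case (3 q q' Q)
  obtain \<tau>1 where \<tau>1: "\<tau>1 = exec read_step (\<sigma>(rB := [SAnd]))" by blast
  obtain \<tau>2 where \<tau>2: "\<tau>2 = iter read_step rB (enc_form (Atom q)) \<tau>1" by blast
  note s1 = read_step_symbol[OF 3(4) assms(3) 3(5), of SAnd, folded \<tau>1, simplified]
  have d1: "\<tau>1 rDer = ctext es" using \<tau>1 3(4) by simp
  have d2: "\<tau>2 rDer = ctext es" using \<tau>2 d1 by (simp del: enc_form.simps)
  have i1: "\<tau>1 rItem = [] \<or> (\<exists>A. literal A \<and> \<tau>1 rItem = enc_form A)" using s1 by simp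
  note s2 = read_step_literal[of \<tau>1 es "Atom q", OF d1 assms(3) i1 literal_simps(1), folded \<tau>2, simplified s1]
  have i2: "\<tau>2 rItem = [] \<or> (\<exists>A. literal A \<and> \<tau>2 rItem = enc_form A)"
    using s1 s2 literal_simps by blast
  have "iter read_step rB (enc_form (Conj (map Atom (q # q' # Q)))) \<sigma> =
      iter read_step rB (enc_form (Conj (map Atom (q' # Q)))) \<tau>2"
    by (simp add: \<tau>1 \<tau>2)
  moreover have "pending (enc_form (Atom q)) es \<longleftrightarrow> Atom q \<in> set es"
    by (rule pending_literal[OF assms(3)]) simp_all
  moreover have "pending [] es" by (simp add: pending_def)
  moreover obtain \<theta> where \<theta>: "\<theta> = iter read_step rB (enc_form (Conj (map Atom (q' # Q)))) \<tau>2" by blast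
  moreover note 3(2)[OF _ d2 i2, folded \<theta>]
  ultimately show ?case
    using s1 s2 by auto
qed simp

definition clean :: "regs \<Rightarrow> bool" where
  "clean \<sigma> \<longleftrightarrow> \<sigma> rForm = [] \<and> \<sigma> rPrem = [] \<and> \<sigma> rItem = [] \<and> \<sigma> rFail = []"

lemma read_step_clause:
  fixes Q :: "nat list"
  assumes "\<sigma> rDer = ctext es" "\<And>e. e \<in> set es \<Longrightarrow> literal e" "clean \<sigma>" "literal h"
  defines "\<tau> \<equiv> iter read_step rB (enc_form (clause_form (Q, h))) \<sigma>"
  shows "\<tau> rForm = enc_form (clause_form (Q, h)) \<and> \<tau> rItem = enc_form h \<and>
    \<tau> rPrem = (if Q = [] then [] else enc_form (Conj (map Atom Q))) \<and>
    (\<tau> rFail = []) = (Atom ` set Q \<subseteq> set es)"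
proof (cases "Q = []")
  case True
  then show ?thesis
    using read_step_literal[of \<sigma> es h, OF assms(1,2) _ assms(4)] assms(3)
    by (simp add: \<tau>_def clean_def pending_def)
next
  case False
  let ?w = "enc_form (Conj (map Atom Q))"
  obtain \<tau>1 where \<tau>1: "\<tau>1 = exec read_step (\<sigma>(rB := [SImp]))" by blast
  obtain \<tau>2 where \<tau>2: "\<tau>2 = iter read_step rB ?w \<tau>1" by blast
  have s1: "\<tau>1 rDer = ctext es" "\<tau>1 rForm = [SImp]" "\<tau>1 rPrem = []" "\<tau>1 rItem = []" "\<tau>1 rFail = []"
    using assms(1,3) by (simp_all add: \<tau>1 read_step_SImp clean_def)
  have s2: "\<tau>2 rForm = SImp # ?w" "\<tau>2 rPrem @ \<tau>2 rItem = ?w" "\<tau>2 rItem = enc_form (Atom (last Q))"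
    "(\<tau>2 rFail = []) = (Atom ` set (butlast Q) \<subseteq> set es)"
    using read_step_Conj[of Q \<tau>1 es, OF False s1(1) assms(2), folded \<tau>2] s1 by (auto simp: pending_def)
  have d2: "\<tau>2 rDer = ctext es" using \<tau>2 s1 by simp
  have i2: "\<tau>2 rItem = [] \<or> (\<exists>A. literal A \<and> \<tau>2 rItem = enc_form A)"
    using s2 literal_simps by blast
  \<comment> \<open>The head starts a new item and thereby flushes the last premise, which completes
    the test on all of \<open>Q\<close>.\<close>
  have "\<tau> = iter read_step rB (enc_form h) \<tau>2"
    using False by (simp add: \<tau>_def \<tau>1 \<tau>2)
  moreover have "pending (enc_form (Atom (last Q))) es \<longleftrightarrow> Atom (last Q) \<in> set es"
    by (rule pending_literal[OF assms(2)]) simp_all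
  moreover have "set Q = insert (last Q) (set (butlast Q))"
    using False by (metis append_butlast_last_id list.simps(15) rotate1.simps(2) set_rotate1)
  ultimately show ?thesis
    using read_step_literal[of \<tau>2 es h, OF d2 assms(2) i2 assms(4)] s2 False by auto
qed

text \<open>A head counts at once for the clauses that follow, and a clause fires even if its head
  is already in \<open>es\<close>. Several rounds amount to one pass over a repeated list, and this
  is how they are treated below.\<close>

fun fires :: "form list \<Rightarrow> clause list \<Rightarrow> clause list" where
  "fires es [] = []"
| "fires es (c # cs) = (if Atom ` set (fst c) \<subseteq> set es
     then c # fires (es @ [snd c]) cs else fires es cs)"

abbreviation derived :: "form list \<Rightarrow> clause list \<Rightarrow> form list" where
  "derived es cs \<equiv> es @ map snd (fires es cs)"

lemma fires_append: "fires es (cs @ ds) = fires es cs @ fires (derived es cs) ds"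
  by (induction cs arbitrary: es) auto

text \<open>The text of \<open>cut_tree\<close> below up to its innermost leaf, with every cut node
  still open; the brackets missing for these nodes are those collected in
  \<open>rCuts\<close>.\<close>

fun cuts_text :: "form list \<Rightarrow> symbol list \<Rightarrow> form list \<Rightarrow> clause list \<Rightarrow> symbol list" where
  "cuts_text \<Gamma> g es [] = []"
| "cuts_text \<Gamma> g es (c # cs) = SOpen # ctext (\<Gamma> @ es) @ SArrow # g @
     enc_proof (clause_tree (\<Gamma> @ es) c) @ cuts_text \<Gamma> g (es @ [snd c]) cs"

lemma cuts_text_append:
  "cuts_text \<Gamma> g es (cs @ ds) = cuts_text \<Gamma> g es cs @ cuts_text \<Gamma> g (es @ map snd cs) ds"
  by (induction cs arbitrary: es) auto

definition progress :: "form list \<Rightarrow> form list \<Rightarrow> clause list \<Rightarrow> regs \<Rightarrow> regs \<Rightarrow> bool" where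
  "progress \<Gamma> es cs \<sigma> \<tau> \<longleftrightarrow> clean \<tau> \<and> \<tau> rDer = ctext (derived es cs) \<and>
     \<tau> rOut = \<sigma> rOut @ cuts_text \<Gamma> (\<sigma> rGoal) es (fires es cs) \<and>
     \<tau> rCuts = \<sigma> rCuts @ replicate (length (fires es cs)) SClose"

lemma progress_trans:
  assumes "progress \<Gamma> es cs \<sigma> \<tau>" "progress \<Gamma> (derived es cs) ds \<tau> \<theta>" "\<tau> rGoal = \<sigma> rGoal"
  shows "progress \<Gamma> es (cs @ ds) \<sigma> \<theta>"
  using assms by (simp add: progress_def fires_append cuts_text_append replicate_add)

lemma clause_step_clause:
  assumes "\<sigma> rDer = ctext es" "\<And>e. e \<in> set es \<Longrightarrow> literal e" "clean \<sigma>" "literal (snd c)"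
    and "\<sigma> rC = ctext \<Gamma>"
  shows "progress \<Gamma> es [c] \<sigma> (iter clause_step rB (enc_form (clause_form c) @ [SComma]) \<sigma>)"
proof -
  obtain Q h where c: "c = (Q, h)" by fastforce
  obtain \<tau> where \<tau>: "\<tau> = iter read_step rB (enc_form (clause_form c)) \<sigma>" by blast
  have s: "\<tau> rForm = enc_form (clause_form (Q, h))" "\<tau> rItem = enc_form h"
    "\<tau> rPrem = (if Q = [] then [] else enc_form (Conj (map Atom Q)))"
    "(\<tau> rFail = []) = (Atom ` set Q \<subseteq> set es)"
    using read_step_clause[OF assms(1-3), of h Q] assms(4) c by (auto simp: \<tau>)
  have m: "\<tau> rDer = ctext es" "\<tau> rC = ctext \<Gamma>" "\<tau> rOut = \<sigma> rOut" "\<tau> rGoal = \<sigma> rGoal" "\<tau> rCuts = \<sigma> rCuts"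
    using assms(1,5) by (simp_all add: \<tau> c)
  have it: "iter clause_step rB (enc_form (clause_form c) @ [SComma]) \<sigma> = exec clause_step (\<tau>(rB := [SComma]))"
    using iter_clause_step[OF enc_form_symbols(1)] by (simp add: \<tau>)
  have f: "exec fire (\<tau>(rB := [SComma])) rOut = \<sigma> rOut @ SOpen # ctext (\<Gamma> @ es) @ SArrow # \<sigma> rGoal @
      enc_proof (clause_tree (\<Gamma> @ es) (Q, h))"
    "exec fire (\<tau>(rB := [SComma])) rDer = ctext (es @ [h])"
    "exec fire (\<tau>(rB := [SComma])) rCuts = \<sigma> rCuts @ [SClose]"
    using exec_fire[of "\<tau>(rB := [SComma])" Q h \<Gamma> es] s(1-3) m by simp_all
  show ?thesis
    unfolding it using s(4) m f
    by (auto simp: progress_def clean_def clause_step_def c simp del: clause_tree.simps)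
qed

lemma set_fires: "set (fires es cs) \<subseteq> set cs"
  by (induction cs arbitrary: es) auto

lemma literal_derived:
  assumes "\<And>e. e \<in> set es \<Longrightarrow> literal e" "\<And>c. c \<in> set cs \<Longrightarrow> literal (snd c)" "e \<in> set (derived es cs)"
  shows "literal e"
  using assms set_fires[of es cs] by auto

lemma clause_step_clauses:
  assumes "\<sigma> rDer = ctext es" "\<And>e. e \<in> set es \<Longrightarrow> literal e" "clean \<sigma>"
    "\<And>c. c \<in> set cs \<Longrightarrow> literal (snd c)" "\<sigma> rC = ctext \<Gamma>"
  shows "progress \<Gamma> es cs \<sigma> (iter clause_step rB (ctext (map clause_form cs)) \<sigma>)"
  using assms
proof (induction cs arbitrary: es \<sigma>)
  case Nil
  then show ?case by (simp add: progress_def)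
next
  case (Cons c cs)
  obtain \<tau> where \<tau>: "\<tau> = iter clause_step rB (enc_form (clause_form c) @ [SComma]) \<sigma>" by blast
  have p: "progress \<Gamma> es [c] \<sigma> \<tau>"
    unfolding \<tau> using Cons.prems by (intro clause_step_clause) auto
  have "progress \<Gamma> (derived es [c]) cs \<tau> (iter clause_step rB (ctext (map clause_form cs)) \<tau>)"
  proof (rule Cons.IH)
    show "literal e" if "e \<in> set (derived es [c])" for e
      using that Cons.prems by (intro literal_derived[of es "[c]" e]) auto
    show "\<tau> rC = ctext \<Gamma>" using Cons.prems(5) by (simp add: \<tau>)
  qed (use p Cons.prems in \<open>auto simp: progress_def\<close>)
  from progress_trans[OF p this] have
    "progress \<Gamma> es ([c] @ cs) \<sigma> (iter clause_step rB (ctext (map clause_form cs)) \<tau>)"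
    by (simp add: \<tau> del: iter_simps)
  then show ?case by (simp add: \<tau>)
qed

lemma rounds:
  assumes "\<sigma> rDer = ctext es" "\<And>e. e \<in> set es \<Longrightarrow> literal e" "clean \<sigma>"
    "\<And>c. c \<in> set cs \<Longrightarrow> literal (snd c)" "\<sigma> rC = ctext \<Gamma>" "\<sigma> rB = ctext (map clause_form cs)"
  shows "progress \<Gamma> es (concat (replicate (length w) cs)) \<sigma> (iter (Loop rB clause_step) rA w \<sigma>)"
  using assms
proof (induction w arbitrary: es \<sigma>)
  case Nil
  then show ?case by (simp add: progress_def)
next
  case (Cons a w)
  obtain \<tau> where \<tau>: "\<tau> = exec (Loop rB clause_step) (\<sigma>(rA := [a]))" by blast
  have "progress \<Gamma> es cs (\<sigma>(rA := [a])) (iter clause_step rB (ctext (map clause_form cs)) (\<sigma>(rA := [a])))"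
    using Cons.prems by (intro clause_step_clauses) (auto simp: clean_def)
  then have p: "progress \<Gamma> es cs \<sigma> \<tau>"
    using Cons.prems(6) by (simp add: progress_def \<tau> clean_def)
  have "progress \<Gamma> (derived es cs) (concat (replicate (length w) cs)) \<tau> (iter (Loop rB clause_step) rA w \<tau>)"
  proof (rule Cons.IH)
    show "literal e" if "e \<in> set (derived es cs)" for e
      using that Cons.prems(2,4) by (rule literal_derived[of es cs e, rotated -1])
    show "\<tau> rC = ctext \<Gamma>" using Cons.prems(5) by (simp add: \<tau>)
    show "\<tau> rB = ctext (map clause_form cs)" using Cons.prems(6) by (simp add: \<tau>)
  qed (use p Cons.prems in \<open>auto simp: progress_def\<close>)
  from progress_trans[OF p this] show ?case by (simp add: \<tau>)
qed

fun cut_tree :: "form list \<Rightarrow> form \<Rightarrow> form list \<Rightarrow> clause list \<Rightarrow> proof_tree" where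
  "cut_tree \<Gamma> g es [] = Node (\<Gamma> @ es, Some g) []"
| "cut_tree \<Gamma> g es (c # cs) = Node (\<Gamma> @ es, Some g)
     [clause_tree (\<Gamma> @ es) c, cut_tree \<Gamma> g (es @ [snd c]) cs]"

lemma enc_cut_tree:
  "enc_proof (cut_tree \<Gamma> g es cs) = cuts_text \<Gamma> (enc_form g) es cs @
     SOpen # ctext (\<Gamma> @ es @ map snd cs) @ SArrow # enc_form g @ replicate (Suc (length cs)) SClose"
  by (induction cs arbitrary: es)
    (simp_all add: enc_sequent_ctext replicate_append_same[symmetric] del: enc_sequent.simps clause_tree.simps)

lemma exec_main:
  assumes "\<sigma> rA = ctext \<Gamma>" "\<sigma> rB = ctext \<Gamma>" "\<sigma> rC = ctext \<Gamma>" "\<Gamma> = map clause_form cs"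
    and "\<And>c. c \<in> set cs \<Longrightarrow> literal (snd c)"
  defines "ds \<equiv> fires [] (concat (replicate (length (ctext \<Gamma>)) cs))"
  shows "exec main \<sigma> rDer = ctext (map snd ds)"
    and "\<sigma> rGoal = enc_form g \<Longrightarrow> exec main \<sigma> rOut = \<sigma> rOut @ enc_proof (cut_tree \<Gamma> g [] ds)"
proof -
  let ?\<sigma> = "\<sigma>(rDer := [], rCuts := [], rForm := [], rPrem := [], rItem := [], rFail := [])"
  obtain \<tau> where \<tau>: "\<tau> = iter (Loop rB clause_step) rA (ctext \<Gamma>) ?\<sigma>" by blast
  have "progress \<Gamma> [] (concat (replicate (length (ctext \<Gamma>)) cs)) ?\<sigma> \<tau>"
    unfolding \<tau> using assms(2-5) by (intro rounds) (auto simp: clean_def)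
  then have p: "\<tau> rDer = ctext (map snd ds)" "\<tau> rOut = \<sigma> rOut @ cuts_text \<Gamma> (\<sigma> rGoal) [] ds"
    "\<tau> rCuts = replicate (length ds) SClose"
    by (auto simp: progress_def ds_def)
  have m: "\<tau> rGoal = \<sigma> rGoal" "\<tau> rC = ctext \<Gamma>" using assms(3) by (simp_all add: \<tau>)
  have "exec main \<sigma> = exec (Push rOut SOpen ;; ctx ;; append_reg rGoal rOut ;; Push rOut SClose ;; append_reg rCuts rOut)
      (\<tau>(rA := ctext \<Gamma>))"
    using assms(1) by (simp add: main_def \<tau>)
  then show "exec main \<sigma> rDer = ctext (map snd ds)"
    and "\<sigma> rGoal = enc_form g \<Longrightarrow> exec main \<sigma> rOut = \<sigma> rOut @ enc_proof (cut_tree \<Gamma> g [] ds)"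
    using p m by (simp_all add: enc_cut_tree ctx_text_def)
qed

section \<open>Selection of the goal\<close>

text \<open>A non-empty \<open>rGoal\<close> stops the counter as well, so \<open>rIndex\<close>
  stays at the first suitable atom. Counting precedes the test, which makes the indices start at
  one. If \<bottom> is derived, the first atom is taken.\<close>

definition select_item :: prog where
  "select_item = IfTop rItem None Skip
     (IfTop rGoal None
        (Inc rIndex ;; Clear rFound ;; mem rBot ;; mem rItem ;; IfTop rFound None Skip (append_reg rItem rGoal))
        Skip ;;
      Clear rItem)"

definition select_step :: prog where
  "select_step = IfTop rGoals (Some SOr) select_item
     (IfTop rGoals (Some SVar) (select_item ;; Copy rGoals rItem) (Copy rGoals rItem))"

text \<open>The pushed \<open>SOr\<close> ends the last item.\<close>

definition select :: prog where
  "select = Clear rItem ;; Push rBot SBot ;; Push rGoals SOr ;; Loop rGoals select_step"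

definition split_step :: prog where
  "split_step = IfTop rIn (Some SArrow) (Push rArrow STop)
     (IfTop rArrow None (Copy rIn rA ;; Copy rIn rB ;; Copy rIn rC) (Copy rIn rGoals))"

text \<open>In its first run, \<open>main\<close> finds the empty word in \<open>rGoal\<close>, and what it prints is discarded.\<close>

definition prover :: prog where
  "prover = Loop rIn split_step ;; main ;; select ;; Clear rOut ;; append_reg rIndex rOut ;; main"

lemma mods_select_item [simp]: "mods select_item = {rItem, rGoal, rIndex, rWork, rFound}"
  by (auto simp: select_item_def)

lemma mods_select_step [simp]: "mods select_step = {rItem, rGoal, rIndex, rWork, rFound}"
  by (auto simp: select_step_def)

lemma mods_select [simp]: "mods select = {rItem, rGoal, rIndex, rWork, rFound, rBot, rGoals}"
  by (auto simp: select_def)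

lemma mods_split_step [simp]: "mods split_step = {rArrow, rA, rB, rC, rGoals}"
  by (auto simp: split_step_def)

text \<open>The levels follow the flow of data: the input, its parts, the formula and the item read
  from them, the premise text and the derived literals put together from items, the working
  registers, the output. \<open>rBot\<close> can be at level 0 because it is filled outside all
  loops.\<close>

lemma stratified_prover:
  "stratified 21 (\<lambda>r. if r < 21 then
     [0, 5, 1, 1, 1, 1, 1, 2, 3, 2, 3, 4, 4, 4, 4, 4, 4, 4, 4, 4, 0] ! r else 0) {} prover"
  unfolding prover_def main_def select_def select_step_def select_item_def split_step_def
    clause_step_def read_step_def flush_def fire_def emit_conj_def conj_step_def close_leaf_def
    ctx_def mem_def mem_step_def append_reg_def
  by simp

section \<open>Correctness of the selection and of the whole program\<close>

lemma split_left:
  "SArrow \<notin> set w \<Longrightarrow> \<sigma> rArrow = [] \<Longrightarrow> iter split_step rIn w \<sigma> rArrow = [] \<and>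
    iter split_step rIn w \<sigma> rA = \<sigma> rA @ w \<and> iter split_step rIn w \<sigma> rB = \<sigma> rB @ w \<and>
    iter split_step rIn w \<sigma> rC = \<sigma> rC @ w \<and> iter split_step rIn w \<sigma> rGoals = \<sigma> rGoals"
  by (induction w arbitrary: \<sigma>) (auto simp: split_step_def)

lemma split_right:
  "SArrow \<notin> set w \<Longrightarrow> \<sigma> rArrow \<noteq> [] \<Longrightarrow>
    iter split_step rIn w \<sigma> rA = \<sigma> rA \<and> iter split_step rIn w \<sigma> rB = \<sigma> rB \<and>
    iter split_step rIn w \<sigma> rC = \<sigma> rC \<and> iter split_step rIn w \<sigma> rGoals = \<sigma> rGoals @ w"
  by (induction w arbitrary: \<sigma>) (auto simp: split_step_def)

lemma exec_split:
  assumes "SArrow \<notin> set u" "SArrow \<notin> set v" "\<sigma> = (\<lambda>_. [])(rIn := u @ SArrow # v)"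
  defines "\<tau> \<equiv> exec (Loop rIn split_step) \<sigma>"
  shows "\<tau> rA = u" "\<tau> rB = u" "\<tau> rC = u" "\<tau> rGoals = v"
proof -
  obtain \<tau>1 where \<tau>1: "\<tau>1 = iter split_step rIn u \<sigma>" by blast
  have 1: "\<tau>1 rArrow = []" "\<tau>1 rA = u" "\<tau>1 rB = u" "\<tau>1 rC = u" "\<tau>1 rGoals = []"
    using split_left[OF assms(1), of \<sigma>] assms(3) by (auto simp: \<tau>1)
  obtain \<tau>2 where \<tau>2: "\<tau>2 = exec split_step (\<tau>1(rIn := [SArrow]))" by blast
  have 2: "\<tau>2 rArrow \<noteq> []" "\<tau>2 rA = u" "\<tau>2 rB = u" "\<tau>2 rC = u" "\<tau>2 rGoals = []"
    using 1 by (auto simp: \<tau>2 split_step_def)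
  have "\<tau> = (iter split_step rIn v \<tau>2)(rIn := u @ SArrow # v)"
    by (simp add: \<tau>_def assms(3) \<tau>1 \<tau>2)
  then show "\<tau> rA = u" "\<tau> rB = u" "\<tau> rC = u" "\<tau> rGoals = v"
    using split_right[of v \<tau>2, OF assms(2) 2(1)] 2 by auto
qed

text \<open>The effect of \<open>select_item\<close> on index and goal. The empty word can stand for
  a goal not yet found, as no atom has an empty text.\<close>

fun pick :: "form list \<Rightarrow> nat \<Rightarrow> symbol list \<times> symbol list \<Rightarrow> symbol list \<times> symbol list" where
  "pick es p (i, g) = (if g = []
     then (inc i, if Bot \<in> set es \<or> Atom p \<in> set es then enc_form (Atom p) else []) else (i, g))"

text \<open>\<open>xs\<close> has the atom that was read but not yet tested, if there is one: the
  end of an item shows only when the next symbol begins something new.\<close>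

lemma exec_select_item:
  assumes "\<sigma> rDer = ctext es" "\<And>e. e \<in> set es \<Longrightarrow> literal e" "\<sigma> rBot = [SBot]"
    and "\<sigma> rItem = concat (map (\<lambda>p. enc_form (Atom p)) xs)" "length xs \<le> 1"
  defines "\<tau> \<equiv> exec select_item \<sigma>"
  shows "\<tau> rItem = []" "(\<tau> rIndex, \<tau> rGoal) = fold (pick es) xs (\<sigma> rIndex, \<sigma> rGoal)"
proof -
  show "\<tau> rItem = []" by (simp add: \<tau>_def select_item_def)
  show "(\<tau> rIndex, \<tau> rGoal) = fold (pick es) xs (\<sigma> rIndex, \<sigma> rGoal)"
  proof (cases xs)
    case Nil
    then show ?thesis using assms(4) by (simp add: \<tau>_def select_item_def)
  next
    case (Cons p ys)
    then have xs: "xs = [p]" using assms(5) by simp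
    then have it: "\<sigma> rItem = enc_form (Atom p)" using assms(4) by simp
    let ?\<sigma>1 = "\<sigma>(rIndex := inc (\<sigma> rIndex), rFound := [])"
    let ?\<sigma>2 = "exec (mem rBot) ?\<sigma>1"
    have "(?\<sigma>2 rFound = []) = (Bot \<notin> set es)"
      using exec_mem_literal[of rBot ?\<sigma>1 es Bot] assms(1-3) by simp
    then have "(exec (mem rItem) ?\<sigma>2 rFound = []) = (Bot \<notin> set es \<and> Atom p \<notin> set es)"
      using exec_mem_literal[of rItem ?\<sigma>2 es "Atom p"] assms(1,2) it by simp
    then show ?thesis using xs it
      by (simp add: \<tau>_def select_item_def)
  qed
qed

lemma select_step_digits:
  assumes "set w \<subseteq> {S0, S1}"
  shows "iter select_step rGoals w \<sigma> rItem = \<sigma> rItem @ w"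
    "iter select_step rGoals w \<sigma> rIndex = \<sigma> rIndex"
    "iter select_step rGoals w \<sigma> rGoal = \<sigma> rGoal"
  using assms by (induction w arbitrary: \<sigma>) (auto simp: select_step_def)

lemma select_step_atom:
  fixes p :: nat
  assumes "\<sigma> rDer = ctext es" "\<And>e. e \<in> set es \<Longrightarrow> literal e" "\<sigma> rBot = [SBot]"
    and "\<sigma> rItem = concat (map (\<lambda>p. enc_form (Atom p)) xs)" "length xs \<le> 1"
  defines "\<tau> \<equiv> iter select_step rGoals (enc_form (Atom p)) \<sigma>"
  shows "\<tau> rItem = enc_form (Atom p)"
    "(\<tau> rIndex, \<tau> rGoal) = fold (pick es) xs (\<sigma> rIndex, \<sigma> rGoal)"
  using exec_select_item[of "\<sigma>(rGoals := [SVar])" es xs] assms(1-5)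
  by (simp_all add: \<tau>_def select_step_digits[OF enc_nat_digits]) (simp_all add: select_step_def)

lemma select_step_SOr:
  "exec select_step (\<sigma>(rGoals := [SOr])) = exec select_item (\<sigma>(rGoals := [SOr]))"
  by (simp add: select_step_def)

lemma select_steps:
  assumes "ps \<noteq> []" "\<sigma> rDer = ctext es" "\<And>e. e \<in> set es \<Longrightarrow> literal e" "\<sigma> rBot = [SBot]"
    and "\<sigma> rItem = concat (map (\<lambda>p. enc_form (Atom p)) xs)" "length xs \<le> 1"
  defines "\<tau> \<equiv> iter select_step rGoals (enc_form (Disj (map Atom ps)) @ [SOr]) \<sigma>"
  shows "(\<tau> rIndex, \<tau> rGoal) = fold (pick es) (xs @ ps) (\<sigma> rIndex, \<sigma> rGoal)"
  using assms(1,2,4-6) unfolding \<tau>_def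
proof (induction ps arbitrary: xs \<sigma> rule: induct_list012)
  case (2 p)
  obtain \<tau> where \<tau>: "\<tau> = iter select_step rGoals (enc_form (Atom p)) \<sigma>" by blast
  note s = select_step_atom[of \<sigma> es xs p, OF 2(2) assms(3) 2(3-5), folded \<tau>]
  have m: "\<tau> rDer = ctext es" "\<tau> rBot = [SBot]" using 2 by (simp_all add: \<tau> del: enc_form.simps)
  have "iter select_step rGoals (enc_form (Disj (map Atom [p])) @ [SOr]) \<sigma> = exec select_item (\<tau>(rGoals := [SOr]))"
    by (simp add: \<tau> select_step_SOr)
  then show ?case
    using exec_select_item[of "\<tau>(rGoals := [SOr])" es "[p]"] s m assms(3) by simp
next
  case (3 p p' ps)
  obtain \<tau>1 where \<tau>1: "\<tau>1 = exec select_item (\<sigma>(rGoals := [SOr]))" by blast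
  have m1: "\<tau>1 rDer = ctext es" "\<tau>1 rBot = [SBot]"
    using 3 by (simp_all add: \<tau>1 select_step_SOr[symmetric])
  have s1: "\<tau>1 rItem = concat (map (\<lambda>p. enc_form (Atom p)) [])"
    "(\<tau>1 rIndex, \<tau>1 rGoal) = fold (pick es) xs (\<sigma> rIndex, \<sigma> rGoal)"
    using exec_select_item[of "\<sigma>(rGoals := [SOr])" es xs, folded \<tau>1] 3 assms(3) by simp_all
  obtain \<tau>2 where \<tau>2: "\<tau>2 = iter select_step rGoals (enc_form (Atom p)) \<tau>1" by blast
  note s2 = select_step_atom[of \<tau>1 es "[]" p, OF m1(1) assms(3) m1(2) s1(1), folded \<tau>2]
  have m2: "\<tau>2 rDer = ctext es" "\<tau>2 rBot = [SBot]" using m1 by (simp_all add: \<tau>2 del: enc_form.simps)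
  have "iter select_step rGoals (enc_form (Disj (map Atom (p # p' # ps))) @ [SOr]) \<sigma> =
      iter select_step rGoals (enc_form (Disj (map Atom (p' # ps))) @ [SOr]) \<tau>2"
    by (simp add: \<tau>2 \<tau>1 select_step_SOr)
  then show ?case
    using 3(2)[of \<tau>2 "[p]", OF _ m2] s1 s2 by simp
qed simp

lemma pick_found: "g \<noteq> [] \<Longrightarrow> fold (pick es) ps (i, g) = (i, g)"
  by (induction ps) auto

lemma fold_pick:
  assumes "\<exists>p\<in>set ps. Bot \<in> set es \<or> Atom p \<in> set es"
  shows "\<exists>i<length ps. fold (pick es) ps (enc_nat k, []) = (enc_nat (Suc (k + i)), enc_form (Atom (ps ! i))) \<and>
    (Bot \<in> set es \<or> Atom (ps ! i) \<in> set es)"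
  using assms
proof (induction ps arbitrary: k)
  case (Cons p ps)
  show ?case
  proof (cases "Bot \<in> set es \<or> Atom p \<in> set es")
    case True
    then show ?thesis
      by (intro exI[of _ 0]) (auto simp: pick_found inc_enc_nat)
  next
    case False
    with Cons obtain i where "i < length ps"
      "fold (pick es) ps (enc_nat (Suc k), []) = (enc_nat (Suc (Suc k + i)), enc_form (Atom (ps ! i)))"
      "Bot \<in> set es \<or> Atom (ps ! i) \<in> set es" by fastforce
    with False show ?thesis
      by (intro exI[of _ "Suc i"]) (auto simp: inc_enc_nat)
  qed
qed simp

lemma exec_prover:
  fixes ps :: "nat list"
  assumes "\<Gamma> = map clause_form cs" "\<And>c. c \<in> set cs \<Longrightarrow> literal (snd c)"
  defines "ds \<equiv> fires [] (concat (replicate (length (ctext \<Gamma>)) cs))"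
  assumes "\<exists>p\<in>set ps. Bot \<in> snd ` set ds \<or> Atom p \<in> snd ` set ds"
  shows "\<exists>i<length ps. (Bot \<in> snd ` set ds \<or> Atom (ps ! i) \<in> snd ` set ds) \<and>
    exec prover ((\<lambda>_. [])(0 := enc_sequent (\<Gamma>, Some (Disj (map Atom ps))))) 1 =
      enc_output (Suc i) (cut_tree \<Gamma> (Atom (ps ! i)) [] ds)"
proof -
  let ?es = "map snd ds" and ?\<sigma> = "(\<lambda>_. [])(rIn := enc_sequent (\<Gamma>, Some (Disj (map Atom ps))))"
  have lit: "literal e" if "e \<in> set ?es" for e
    using that assms(2) set_fires[of "[]" "concat (replicate (length (ctext \<Gamma>)) cs)"]
    by (auto simp: ds_def split: if_splits)
  have sym: "SArrow \<notin> set (ctext \<Gamma>)" by (auto simp: ctext_def enc_form_symbols)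
  obtain \<tau>1 where \<tau>1: "\<tau>1 = exec (Loop rIn split_step) ?\<sigma>" by blast
  have 1: "\<tau>1 rA = ctext \<Gamma>" "\<tau>1 rB = ctext \<Gamma>" "\<tau>1 rC = ctext \<Gamma>" "\<tau>1 rGoals = enc_form (Disj (map Atom ps))"
    using exec_split[OF sym enc_form_symbols(2)] unfolding \<tau>1 by (simp_all add: enc_sequent_ctext del: enc_sequent.simps exec_Loop)
  have e1: "\<tau>1 r = []" if "r \<in> {rOut, rGoal, rIndex, rBot}" for r
    using that by (auto simp: \<tau>1)
  obtain \<tau>2 where \<tau>2: "\<tau>2 = exec main \<tau>1" by blast
  have 2: "\<tau>2 rA = ctext \<Gamma>" "\<tau>2 rB = ctext \<Gamma>" "\<tau>2 rC = ctext \<Gamma>" "\<tau>2 rGoals = enc_form (Disj (map Atom ps))"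
    "\<tau>2 rGoal = []" "\<tau>2 rIndex = []" "\<tau>2 rBot = []"
    using 1 e1 by (simp_all add: \<tau>2)
  have d2: "\<tau>2 rDer = ctext ?es"
    using exec_main(1)[OF 1(1-3) assms(1,2)] by (simp add: \<tau>2 ds_def)
  obtain \<tau>3 where \<tau>3: "\<tau>3 = exec select \<tau>2" by blast
  have 3: "\<tau>3 rA = ctext \<Gamma>" "\<tau>3 rB = ctext \<Gamma>" "\<tau>3 rC = ctext \<Gamma>"
    using 2 by (simp_all add: \<tau>3)
  have "ps \<noteq> []" using assms(4) by auto
  then have "(\<tau>3 rIndex, \<tau>3 rGoal) = fold (pick ?es) ps ([], [])"
    using select_steps[of ps "\<tau>2(rItem := [], rBot := [SBot], rGoals := \<tau>2 rGoals @ [SOr])" ?es "[]"]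
      2 d2 lit by (simp add: \<tau>3 select_def)
  moreover obtain i where i: "i < length ps" "Bot \<in> set ?es \<or> Atom (ps ! i) \<in> set ?es"
    "fold (pick ?es) ps ([], []) = (enc_nat (Suc i), enc_form (Atom (ps ! i)))"
    using fold_pick[of ps ?es 0] assms(4) by auto
  ultimately have g: "\<tau>3 rIndex = enc_nat (Suc i)" "\<tau>3 rGoal = enc_form (Atom (ps ! i))" by auto
  obtain \<tau>4 where \<tau>4: "\<tau>4 = \<tau>3(rOut := enc_nat (Suc i))" by blast
  have 4: "\<tau>4 rA = ctext \<Gamma>" "\<tau>4 rB = ctext \<Gamma>" "\<tau>4 rC = ctext \<Gamma>" "\<tau>4 rGoal = enc_form (Atom (ps ! i))"
    using 3 g by (simp_all add: \<tau>4)
  have "exec prover ?\<sigma> = exec main \<tau>4"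
    using g by (simp add: prover_def \<tau>4 \<tau>3 \<tau>2 \<tau>1 del: exec_Loop)
  moreover have "exec main \<tau>4 rOut = \<tau>4 rOut @ enc_proof (cut_tree \<Gamma> (Atom (ps ! i)) [] ds)"
    using exec_main(2)[OF 4(1-3) assms(1,2) 4(4)] unfolding ds_def .
  moreover have "\<tau>4 rOut = enc_nat (Suc i)"
    by (simp add: \<tau>4)
  ultimately have "exec prover ?\<sigma> rOut = enc_output (Suc i) (cut_tree \<Gamma> (Atom (ps ! i)) [] ds)"
    by (simp add: enc_output_def)
  with i show ?thesis by auto
qed

section \<open>Soundness of the proof trees\<close>

lemma endsequent_conj_tree: "endsequent (conj_tree \<Delta> Q) = (mset \<Delta>, Some (Conj (map Atom Q)))"
  by (cases "(\<Delta>, Q)" rule: conj_tree.cases) auto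

lemma LJ_Ax: "A \<in># \<Gamma> \<Longrightarrow> LJ_rule [] (\<Gamma>, Some A)"
  by (metis LJ_rule.Ax multi_member_split)

lemma LJ_conj_tree:
  "Atom ` set Q \<subseteq> set \<Delta> \<Longrightarrow> Q \<noteq> [] \<Longrightarrow> LJ_proof (conj_tree \<Delta> Q)"
proof (induction \<Delta> Q rule: conj_tree.induct)
  case (1 \<Delta> q q' Q)
  then show ?case by (auto simp: endsequent_conj_tree intro!: LJ_Ax LJ_rule.AndR)
qed (auto intro!: LJ_Ax)

lemma endsequent_clause_tree: "endsequent (clause_tree \<Delta> c) = (mset \<Delta>, Some (snd c))"
  by (cases c) auto

lemma LJ_clause_tree:
  assumes "clause_form c \<in> set \<Delta>" "Atom ` set (fst c) \<subseteq> set \<Delta>"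
  shows "LJ_proof (clause_tree \<Delta> c)"
proof -
  obtain Q h where c: "c = (Q, h)" by fastforce
  show ?thesis
  proof (cases "Q = []")
    case True
    then show ?thesis using assms c by (auto intro!: LJ_Ax)
  next
    case False
    let ?A = "Imp (Conj (map Atom Q)) h"
    have "?A \<in># mset \<Delta>" using assms(1) c False by simp
    then obtain \<Gamma> where "mset \<Delta> = add_mset ?A \<Gamma>" by (metis multi_member_split)
    then have "LJ_rule [(add_mset ?A (mset \<Delta>), Some h)] (mset \<Delta>, Some h)"
      by (simp add: LJ_rule.CtrL)
    moreover have "LJ_rule [(mset \<Delta>, Some (Conj (map Atom Q))), (add_mset h (mset \<Delta>), Some h)]
        (add_mset ?A (mset \<Delta>), Some h)"
      by (rule LJ_rule.ImpL)
    ultimately show ?thesis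
      using LJ_conj_tree[of Q \<Delta>] assms(2) c False
      by (auto simp: endsequent_conj_tree intro!: LJ_Ax)
  qed
qed

lemma endsequent_cut_tree: "endsequent (cut_tree \<Gamma> g es ds) = (mset (\<Gamma> @ es), Some g)"
  by (cases "(\<Gamma>, g, es, ds)" rule: cut_tree.cases) auto

text \<open>All of \<open>derived es cs\<close> is in the antecedent of the innermost leaf, which is
  an axiom on \<open>g\<close> or, with \<bottom> among these literals, an instance of
  \<open>BotL\<close> for any \<open>g\<close>. Induction runs over \<open>cs\<close>, as a clause
  that does not fire leaves the tree unchanged.\<close>

lemma LJ_cut_tree:
  assumes "clause_form ` set cs \<subseteq> set \<Gamma>"
    and "Bot \<in> set (derived es cs) \<or> g \<in> set (derived es cs)"
  shows "LJ_proof (cut_tree \<Gamma> g es (fires es cs))"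
  using assms
proof (induction cs arbitrary: es)
  case Nil
  then have "LJ_rule [] (mset (\<Gamma> @ es), Some g)"
  proof (elim disjE)
    assume "Bot \<in> set (derived es [])"
    then have "Bot \<in># mset (\<Gamma> @ es)" by simp
    then show ?thesis by (metis LJ_rule.BotL multi_member_split)
  qed (auto intro: LJ_Ax)
  then show ?case by simp
next
  case (Cons c cs)
  show ?case
  proof (cases "Atom ` set (fst c) \<subseteq> set es")
    case True
    have "LJ_proof (cut_tree \<Gamma> g (es @ [snd c]) (fires (es @ [snd c]) cs))"
      using Cons.prems True by (intro Cons.IH) auto
    moreover have "LJ_proof (clause_tree (\<Gamma> @ es) c)"
      using Cons.prems True by (intro LJ_clause_tree) auto
    moreover have "LJ_rule [(mset (\<Gamma> @ es), Some (snd c)), (add_mset (snd c) (mset (\<Gamma> @ es)), Some g)]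
        (mset (\<Gamma> @ es), Some g)"
      by (rule LJ_rule.Cut)
    ultimately show ?thesis using True
      by (simp add: endsequent_clause_tree endsequent_cut_tree)
  next
    case False
    then show ?thesis using Cons by auto
  qed
qed

section \<open>Completeness of unit propagation\<close>

definition unit_closed :: "clause list \<Rightarrow> form set \<Rightarrow> bool" where
  "unit_closed cs X \<longleftrightarrow> (\<forall>c\<in>set cs. Atom ` set (fst c) \<subseteq> X \<longrightarrow> snd c \<in> X)"

text \<open>\<open>es\<close> only grows during a pass, so premises present at the start are still
  there when the turn of \<open>c\<close> comes.\<close>

lemma derived_fires: "c \<in> set cs \<Longrightarrow> Atom ` set (fst c) \<subseteq> set es \<Longrightarrow> snd c \<in> set (derived es cs)"
proof (induction cs arbitrary: es)
  case (Cons d cs)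
  show ?case
  proof (cases "c = d")
    case True
    then show ?thesis using Cons by simp
  next
    case False
    then have "c \<in> set cs" using Cons by simp
    from Cons.IH[OF this, of es] Cons.IH[OF this, of "es @ [snd d]"] Cons.prems(2)
    show ?thesis by auto
  qed
qed simp

lemma derived_closed: "unit_closed cs (set es) \<Longrightarrow> set (derived es cs) = set es"
proof -
  have "set (derived es ds) = set es" if "unit_closed cs (set es)" "set ds \<subseteq> set cs" for ds
    using that
  proof (induction ds arbitrary: es)
    case (Cons d ds)
    show ?case
    proof (cases "Atom ` set (fst d) \<subseteq> set es")
      case True
      then have "set (es @ [snd d]) = set es"
        using Cons.prems by (auto simp: unit_closed_def)
      then show ?thesis using True Cons.prems Cons.IH[of "es @ [snd d]"] by auto
    next
      case False
      then show ?thesis using Cons by auto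
    qed
  qed simp
  then show "unit_closed cs (set es) \<Longrightarrow> set (derived es cs) = set es" by simp
qed

text \<open>Hence as many rounds as there are clauses suffice.\<close>

lemma closed_or_grows:
  "unit_closed cs (set (derived [] (concat (replicate n cs)))) \<or>
   n \<le> card (set (derived [] (concat (replicate n cs))))"
proof (induction n)
  case (Suc n)
  let ?es = "derived [] (concat (replicate n cs))"
  have eq: "derived [] (concat (replicate (Suc n) cs)) = derived ?es cs"
    by (subst replicate_Suc, subst replicate_append_same[symmetric]) (simp add: fires_append)
  show ?case
  proof (cases "unit_closed cs (set ?es)")
    case True
    then show ?thesis using derived_closed[OF True] unfolding eq by simp
  next
    case False
    then obtain c where "c \<in> set cs" "Atom ` set (fst c) \<subseteq> set ?es" "snd c \<notin> set ?es"
      by (auto simp: unit_closed_def)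
    with derived_fires[of c cs ?es] have "set ?es \<subset> set (derived ?es cs)" by auto
    then have "card (set ?es) < card (set (derived ?es cs))" by (intro psubset_card_mono) auto
    with False Suc show ?thesis unfolding eq by linarith
  qed
qed simp

text \<open>Without closure there would be at least \<open>n\<close> distinct literals, all of them
  heads of \<open>cs\<close>, of which there are at most \<open>length cs\<close>. So every head is
  derived, and such a set is closed after all.\<close>

lemma closed_fires:
  assumes "length cs \<le> n"
  shows "unit_closed cs (snd ` set (fires [] (concat (replicate n cs))))"
proof (rule disjE[OF closed_or_grows[of cs n]])
  let ?X = "set (derived [] (concat (replicate n cs)))"
  assume "n \<le> card ?X"
  have "set (fires [] (concat (replicate n cs))) \<subseteq> set cs"
    using set_fires[of "[]" "concat (replicate n cs)"] by (auto split: if_splits)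
  then have sub: "?X \<subseteq> snd ` set cs" by auto
  have "card (snd ` set cs) \<le> length cs"
    by (metis card_length card_image_le List.finite_set le_trans)
  then have "?X = snd ` set cs"
    using sub \<open>n \<le> card ?X\<close> assms by (intro card_seteq) (simp_all only: finite_set finite_imageI le_trans)
  then show ?thesis by (auto simp: unit_closed_def)
qed auto

lemma eval_Conj: "eval v (Conj As) \<longleftrightarrow> (\<forall>A\<in>set As. eval v A)"
  by (induction As rule: Conj.induct) auto

lemma eval_Disj: "eval v (Disj As) \<longleftrightarrow> (\<exists>A\<in>set As. eval v A)"
  by (induction As rule: Disj.induct) auto

lemma unit_propagation_complete:
  assumes "classically_valid (map clause_form cs, Some (Disj (map Atom ps)))"
    and "\<And>c. c \<in> set cs \<Longrightarrow> literal (snd c)" "unit_closed cs X" "Bot \<notin> X"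
  shows "\<exists>p\<in>set ps. Atom p \<in> X"
proof -
  let ?v = "\<lambda>a. Atom a \<in> X"
  have "eval ?v (clause_form c)" if "c \<in> set cs" for c
  proof -
    obtain Q h where c: "c = (Q, h)" by fastforce
    have "Atom ` set Q \<subseteq> X \<longrightarrow> h \<in> X" using assms(3) that c by (fastforce simp: unit_closed_def)
    moreover have "h \<in> X \<Longrightarrow> eval ?v h"
      using assms(2)[OF that] assms(4) c by (auto simp: literal_def)
    ultimately show ?thesis by (auto simp: c eval_Conj image_subset_iff)
  qed
  then show ?thesis
    using assms(1) by (auto simp: tautology_def eval_Conj eval_Disj)
qed

lemma implicational_horn_clause:
  assumes "implicational_horn A"
  shows "\<exists>c. A = clause_form c \<and> literal (snd c)"
proof -
  consider "literal A" | Q r where "Q \<noteq> []" "literal r" "A = Imp (Conj (map Atom Q)) r"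
    using assms unfolding implicational_horn_def literal_def by blast
  then show ?thesis
  proof cases
    case 1
    then show ?thesis by (intro exI[of _ "([], A)"]) simp
  next
    case 2
    then show ?thesis by (intro exI[of _ "(Q, r)"]) simp
  qed
qed

theorem theorem4p13:
  "\<exists>(M :: symbol tm) (p :: nat poly).
     turing_machine M \<and>
     (\<forall>(\<Gamma> :: form list) (ps :: nat list) (S :: sequent).
        S = (\<Gamma>, Some (Disj (map Atom ps))) \<and>
        1 \<le> length ps \<and>
        (\<forall>A \<in> set \<Gamma>. implicational_horn A) \<and>
        classically_valid S \<longrightarrow>
        (\<exists>i \<pi>. 1 \<le> i \<and> i \<le> length ps \<and>
           LJ_proof \<pi> \<and>
           endsequent \<pi> = (mset \<Gamma>, Some (Atom (ps ! (i - 1)))) \<and>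
           computes_within M (enc_sequent S) (poly p (length (enc_sequent S))) (enc_output i \<pi>)))"
proof -
  have "(if r < 21 then [0, 5, 1, 1, 1, 1, 1, 2, 3, 2, 3, 4, 4, 4, 4, 4, 4, 4, 4, 4, 0] ! r else 0)
      \<le> (5 :: nat)" for r :: nat
    by (auto simp: nth_Cons' numeral_eq_Suc)
  from polynomial_time[OF stratified_prover _ this]
  obtain M :: "symbol tm" and p where M: "turing_machine M"
    "\<And>x. computes_within M x (poly p (length x)) (exec prover ((\<lambda>_. [])(0 := x)) 1)" by auto
  have "\<exists>i \<pi>. 1 \<le> i \<and> i \<le> length ps \<and> LJ_proof \<pi> \<and>
      endsequent \<pi> = (mset \<Gamma>, Some (Atom (ps ! (i - 1)))) \<and>
      computes_within M (enc_sequent S) (poly p (length (enc_sequent S))) (enc_output i \<pi>)"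
    if S: "S = (\<Gamma>, Some (Disj (map Atom ps)))" and ps: "1 \<le> length ps"
      and horn: "\<forall>A \<in> set \<Gamma>. implicational_horn A" and valid: "classically_valid S" for \<Gamma> ps S
  proof -
    \<comment> \<open>The decomposition into clauses serves the analysis only; the program reads the
      formulas themselves, so any choice will do.\<close>
    define clause_of where "clause_of A = (SOME c. A = clause_form c \<and> literal (snd c))" for A
    define cs where "cs = map clause_of \<Gamma>"
    have of: "A = clause_form (clause_of A) \<and> literal (snd (clause_of A))" if "A \<in> set \<Gamma>" for A
      unfolding clause_of_def using implicational_horn_clause horn that by (metis (mono_tags, lifting) someI_ex)
    then have cs: "\<Gamma> = map clause_form cs" by (simp add: cs_def map_idI)
    have lit: "literal (snd c)" if "c \<in> set cs" for c
      using that of by (auto simp: cs_def)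
    define ds where "ds = fires [] (concat (replicate (length (ctext \<Gamma>)) cs))"
    \<comment> \<open>Each formula contributes at least its comma, so there are at least as many
      rounds as clauses.\<close>
    have "length As \<le> length (ctext As)" for As by (induction As) auto
    from this[of \<Gamma>] have "length cs \<le> length (ctext \<Gamma>)" by (simp add: cs_def)
    then have "unit_closed cs (snd ` set ds)" unfolding ds_def by (rule closed_fires)
    then have "\<exists>p\<in>set ps. Bot \<in> snd ` set ds \<or> Atom p \<in> snd ` set ds"
      using unit_propagation_complete[of cs ps] valid lit ps unfolding S cs
      by (metis One_nat_def last_in_set list.size(3) not_one_le_zero)
    then obtain i where i: "i < length ps" "Bot \<in> snd ` set ds \<or> Atom (ps ! i) \<in> snd ` set ds"
      and out: "exec prover ((\<lambda>_. [])(0 := enc_sequent S)) 1 =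
        enc_output (Suc i) (cut_tree \<Gamma> (Atom (ps ! i)) [] ds)"
      using exec_prover[OF cs lit, folded ds_def] unfolding S by blast
    have "LJ_proof (cut_tree \<Gamma> (Atom (ps ! i)) [] ds)"
      unfolding ds_def
    proof (rule LJ_cut_tree)
      show "clause_form ` set (concat (replicate (length (ctext \<Gamma>)) cs)) \<subseteq> set \<Gamma>"
        by (auto simp: cs split: if_splits)
    qed (use i(2) in \<open>auto simp: ds_def\<close>)
    moreover note M(2)[of "enc_sequent S", unfolded out]
    ultimately show ?thesis
      using i(1) by (intro exI[of _ "Suc i"] exI conjI) (auto simp: endsequent_cut_tree)
  qed
  with M(1) show ?thesis by blast
qed

end
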